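(* Let $G$ be a graph on $n$ vertices with adjacency matrix $A(G)$ and walk-matrix $W(G)$, and suppose $\det W(G)\neq 0$. Let $d_n=d_n(W(G))$ be the $n$-th invariant factor of $W(G)$. Suppose that $Q\in\mathcal{Q}(G)$ has level $\ell$. Then: (i) for an odd prime $p$, if $\operatorname{rank}_p W(G)=n-1$, then $\ell\mid \frac{d_n}{p}$; (ii) for $p=2$, if $\operatorname{rank}_2 W(G)=\lceil \frac n2\rceil$, then $\ell\mid \frac{d_n}{2}$.
   Context: All graphs are simple. The walk-matrix of a graph $G$ on $n$ vertices with adjacency matrix $A=A(G)$ is the $n\times n$ integral matrix $W(G)=[e,Ae,\ldots,A^{n-1}e]$, where $e$ is the all-one vector. For a prime $p$, $\operatorname{rank}_p X$ is the rank of an integral matrix $X$ over the finite field $\mathbb{F}_p$. For an $n\times n$ integral matrix $X$ of full rank, $d_1(X)\mid d_2(X)\mid\cdots\mid d_n(X)$ denote the invariant factors of $X$, i.e. the diagonal entries of its Smith Normal Form. A rational orthogonal matrix $Q$ (orthogonal with rational entries) is regular if $Qe=e$; $RO_n(\mathbb{Q})$ is the set of all $n\times n$ regular rational orthogonal matrices, and $\mathcal{Q}(G)=\{Q\in RO_n(\mathbb{Q}) : Q^{T}A(G)Q \text{ is a } (0,1)\text{-matrix}\}$. The level of a rational matrix $Q$ is the smallest positive integer $k$ such that $kQ$ is an integral matrix.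
   Formalization: In (ii) it is additionally assumed that n ≥ 2: for the one-vertex graph, W(G)=[1] has rank_2 W(G)=1=⌈1/2⌉ and d_n=ℓ=1, so d_n/2 is not an integer and the claim fails. *)

theory Defs
  imports
    "Graph_Theory.Pair_Digraph"
    "Jordan_Normal_Form.Determinant"
    "Jordan_Normal_Form.DL_Rank"
    "Berlekamp_Zassenhaus.Finite_Field"
begin

text \<open>A (finite) simple graph is a \<open>pair_graph\<close>: finitely many vertices, arcs given by a
  symmetric, loop-free set of pairs.  The list \<open>vs\<close> is an enumeration of the vertices, which fixes
  the order of the rows and columns of the matrices.  Indices start at 0.\<close>

definition adjacency_mat :: "'v pair_pre_digraph \<Rightarrow> 'v list \<Rightarrow> int mat" where
  "adjacency_mat G vs =
     mat (length vs) (length vs) (\<lambda>(i, j). if (vs ! i, vs ! j) \<in> parcs G then 1 else 0)"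

definition all_one_vec :: "nat \<Rightarrow> 'a :: one vec" where
  "all_one_vec n = vec n (\<lambda>_. 1)"

definition walk_mat :: "'v pair_pre_digraph \<Rightarrow> 'v list \<Rightarrow> int mat" where
  "walk_mat G vs = (let n = length vs in
     mat_of_cols n
       (map (\<lambda>k. (adjacency_mat G vs ^\<^sub>m k) *\<^sub>v all_one_vec n) [0..<n]))"

text \<open>The rank over the field with \<open>p\<close> elements, where the prime \<open>p\<close> is the cardinality of
  the type argument.\<close>

definition rank_mod :: "'p :: prime_card itself \<Rightarrow> int mat \<Rightarrow> nat" where
  "rank_mod _ X = vec_space.rank (dim_row X) (map_mat of_int X :: 'p mod_ring mat)"

text \<open>Over the integers, \<open>invertible_mat\<close> means unimodular.  The entries
  \<open>S $$ (0,0), S $$ (1,1), \<dots>\<close> are the invariant factors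
  \<open>d\<^sub>1, d\<^sub>2, \<dots>\<close> of \<open>X\<close>, normalised to be nonnegative.\<close>

definition is_smith_normal_form :: "int mat \<Rightarrow> int mat \<Rightarrow> bool" where
  "is_smith_normal_form X S \<longleftrightarrow>
     S \<in> carrier_mat (dim_row X) (dim_col X) \<and>
     diagonal_mat S \<and>
     (\<forall>i < min (dim_row S) (dim_col S). S $$ (i, i) \<ge> 0) \<and>
     (\<forall>i. i + 1 < min (dim_row S) (dim_col S) \<longrightarrow> S $$ (i, i) dvd S $$ (i + 1, i + 1)) \<and>
     (\<exists>U V. U \<in> carrier_mat (dim_row X) (dim_row X) \<and> V \<in> carrier_mat (dim_col X) (dim_col X) \<and>
        invertible_mat U \<and> invertible_mat V \<and> S = U * X * V)"

text \<open>The library's \<open>orthogonal_mat\<close> only asks for pairwise orthogonal nonzero columns, hence the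
  explicit equation here.\<close>

definition regular_orthogonal :: "nat \<Rightarrow> rat mat set" where
  "regular_orthogonal n =
     {Q \<in> carrier_mat n n. Q\<^sup>T * Q = 1\<^sub>m n \<and> Q *\<^sub>v all_one_vec n = all_one_vec n}"

definition regular_orthogonal_of :: "'v pair_pre_digraph \<Rightarrow> 'v list \<Rightarrow> rat mat set" where
  "regular_orthogonal_of G vs =
     {Q \<in> regular_orthogonal (length vs).
        elements_mat (Q\<^sup>T * map_mat of_int (adjacency_mat G vs) * Q) \<subseteq> {0, 1}}"

definition level :: "rat mat \<Rightarrow> nat" where
  "level Q = (LEAST k. k > 0 \<and> elements_mat (of_nat k \<cdot>\<^sub>m Q) \<subseteq> \<int>)"

end

theory Submission
  imports Defs "Jordan_Normal_Form.Char_Poly"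
begin

text \<open>Write \<open>d\<close> for \<open>d\<^sub>n\<close>, \<open>e\<close> for the all-one vector and \<open>B = Q\<^sup>T A Q\<close>.  The Smith normal form gives an integral \<open>X\<close>
  with \<open>W X = d I\<close>, and \<open>Q\<^sup>T W\<close> is the walk matrix \<open>H\<close> of \<open>B\<close>, so \<open>R = d Q = (H X)\<^sup>T\<close> is integral.
  If \<open>W\<close> is singular modulo \<open>p\<close> then \<open>p\<close> divides \<open>d\<close>, and it remains to see that \<open>p\<close> divides \<open>R\<close>.

  When the corank modulo \<open>p\<close> is one, suppose \<open>p\<^sup>k\<close> is the exact power dividing \<open>d\<close> and some column \<open>q\<close>
  of \<open>R\<close> is nonzero modulo \<open>p\<close>.  It spans the left kernel of \<open>W\<close> modulo \<open>p\<close>, whence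
  \<open>A q \<equiv> \<lambda> q\<close> modulo \<open>p\<^sup>k\<close>.  As \<open>q \<bullet> q\<close> and \<open>q \<bullet> A q\<close> vanish modulo \<open>p\<^bsup>2k\<^esup>\<close>, a linear system
  bordered by \<open>q\<close> and \<open>e\<close> can be solved, and this lifts \<open>q\<close> to an eigenvector of \<open>A\<close> modulo
  \<open>p\<^bsup>k+1\<^esup>\<close> orthogonal to \<open>e\<close>.  So \<open>W\<^sup>T\<close> kills a vector modulo \<open>p\<^bsup>k+1\<^esup>\<close> that is nonzero modulo \<open>p\<close>,
  which forces \<open>p\<^bsup>k+1\<^esup>\<close> to divide \<open>d\<close>.

  For \<open>p = 2\<close> it suffices that every kernel vector of \<open>W\<close> modulo 2 is one of \<open>H\<close>.  The common
  characteristic polynomial of \<open>A\<close> and \<open>B\<close> only has coefficients of the parity of \<open>n\<close> modulo 2, and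
  \<open>A\<^sup>i e\<close> is the diagonal of \<open>A\<^bsup>2i\<^esup>\<close> modulo 2.  By Cayley-Hamilton the walk vectors of \<open>A\<close> and of \<open>B\<close> satisfy the
  same recurrence of order \<open>\<lceil>n/2\<rceil>\<close>, and the rank hypothesis says that the first \<open>\<lceil>n/2\<rceil>\<close> walk
  vectors of \<open>A\<close> are independent, so every relation among the walk vectors of \<open>A\<close> is a consequence of
  that recurrence.\<close>

section \<open>Matrices of corank one\<close>

text \<open>The rank is the size of a maximal independent set of columns. Listing that set without
  repetition turns its independence into injectivity of \<open>V\<close>.\<close>

lemma linear_independent_columns_of_rank:
  fixes W :: "'a :: field mat"
  assumes W: "W \<in> carrier_mat n m" and r: "vec_space.rank n W = r"
  obtains V where "V \<in> carrier_mat n r" "set (cols V) \<subseteq> set (cols W)"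
    "\<And>v. v \<in> carrier_vec r \<Longrightarrow> V *\<^sub>v v = 0\<^sub>v n \<Longrightarrow> v = 0\<^sub>v r"
proof -
  interpret vec_space "TYPE('a)" n .
  obtain S where S: "finite S" "maximal S (\<lambda>T. T \<subseteq> set (cols W) \<and> lin_indpt T)"
    using maximal_exists_superset[of "set (cols W)" "\<lambda>T. T \<subseteq> set (cols W) \<and> lin_indpt T" "{}"]
      finite_lin_indpt2 by auto
  then have SW: "S \<subseteq> set (cols W)" and li: "lin_indpt S"
    by (auto simp: maximal_def)
  have card: "card S = r"
    using rank_card_indpt[OF W S(2)] r by simp
  obtain xs where xs: "set xs = S" "distinct xs"
    using finite_distinct_list[OF S(1)] by blast
  have len: "length xs = r"
    using xs card distinct_card by force
  have carr: "set xs \<subseteq> carrier_vec n"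
    using xs SW cols_dim[of W] W by auto
  have V: "mat_of_cols n xs \<in> carrier_mat n r" and cols: "cols (mat_of_cols n xs) = xs"
    using len carr by (auto simp: cols_mat_of_cols)
  show thesis
  proof
    show "mat_of_cols n xs \<in> carrier_mat n r" by (rule V)
    show "set (cols (mat_of_cols n xs)) \<subseteq> set (cols W)"
      using cols xs SW by simp
    show "v = 0\<^sub>v r" if "v \<in> carrier_vec r" "mat_of_cols n xs *\<^sub>v v = 0\<^sub>v n" for v
      using lin_depI[OF V that(1) _ that(2)] cols xs li by auto
  qed
qed



text \<open>A kernel vector off the line of \<open>q\<close> would leave, after elimination of one
  coordinate, a nonzero \<open>y\<close> in the left kernel. Bordering \<open>n - 1\<close>
  independent columns by a column that sees \<open>y\<close> but not \<open>q\<close> would then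
  give a square matrix that is both singular and injective.\<close>

lemma left_kernel_of_corank_one:
  fixes W :: "'a :: field mat"
  assumes W: "W \<in> carrier_mat n n" and n: "n \<ge> 1" and rank: "vec_space.rank n W = n - 1"
    and q: "q \<in> carrier_vec n" "q \<noteq> 0\<^sub>v n" "W\<^sup>T *\<^sub>v q = 0\<^sub>v n"
    and x: "x \<in> carrier_vec n" "W\<^sup>T *\<^sub>v x = 0\<^sub>v n"
  shows "\<exists>c. x = c \<cdot>\<^sub>v q"
proof -
  obtain m where m: "n = Suc m"
    using n by (cases n) auto
  obtain V where V: "V \<in> carrier_mat n m" "set (cols V) \<subseteq> set (cols W)"
    and inj: "\<And>v. v \<in> carrier_vec m \<Longrightarrow> V *\<^sub>v v = 0\<^sub>v n \<Longrightarrow> v = 0\<^sub>v m"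
    using linear_independent_columns_of_rank[OF W rank] unfolding m by auto
  have orth: "col V l \<bullet> z = 0" if "l < m" "W\<^sup>T *\<^sub>v z = 0\<^sub>v n" for l z
  proof -
    have "col V l \<in> set (cols W)"
      using that(1) V by (auto simp: cols_def)
    then obtain k where k: "k < n" "col V l = col W k"
      using W by (auto simp: cols_def)
    have "(W\<^sup>T *\<^sub>v z) $ k = 0"
      using k that(2) by simp
    then show ?thesis
      using k W by simp
  qed
  obtain i where i: "i < n" "q $ i \<noteq> 0"
    using q by (metis eq_vecI carrier_vecD index_zero_vec)
  define y where "y = x - (x $ i / q $ i) \<cdot>\<^sub>v q"
  have y: "y \<in> carrier_vec n" "y $ i = 0"
    using x q i by (auto simp: y_def)
  have Wy: "W\<^sup>T *\<^sub>v y = 0\<^sub>v n"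
    unfolding y_def using W x q
    by (subst mult_minus_distrib_mat_vec[of _ n n]) (auto simp: mult_mat_vec[of _ n n])
  have "y = 0\<^sub>v n"
  proof (rule ccontr)
    assume "y \<noteq> 0\<^sub>v n"
    then obtain j where j: "j < n" "y $ j \<noteq> 0"
      using y by (metis eq_vecI carrier_vecD index_zero_vec)
    \<comment> \<open>Orthogonal to \<open>q\<close> by the choice of the coefficient, while
      \<open>a \<bullet> y = y $ j\<close> because \<open>y $ i = 0\<close>.\<close>
    define a where "a = unit_vec n j - (q $ j / q $ i) \<cdot>\<^sub>v unit_vec n i"
    have a: "a \<in> carrier_vec n"
      by (simp add: a_def)
    have a_scalar: "a \<bullet> z = z $ j - (q $ j / q $ i) * z $ i" if "z \<in> carrier_vec n" for z
      unfolding a_def using i j that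
      by (subst minus_scalar_prod_distrib[of _ n]) auto
    have aq: "a \<bullet> q = 0" and ay: "a \<bullet> y \<noteq> 0"
      using a_scalar[OF q(1)] a_scalar[OF y(1)] i j y by auto
    define M where "M = mat n n (\<lambda>(k, l). if l < m then V $$ (k, l) else a $ k)"
    have M: "M \<in> carrier_mat n n"
      by (simp add: M_def)
    have col_M: "col M l = (if l < m then col V l else a)" if "l < n" for l
      using that V a m by (auto simp: M_def intro!: eq_vecI)
    have "M\<^sup>T *\<^sub>v q = 0\<^sub>v n"
      using M aq orth[OF _ q(3)] by (auto intro!: eq_vecI simp: col_M)
    then have "det M\<^sup>T = 0"
      using det_0_iff_vec_prod_zero_field[of "M\<^sup>T" n] M q by auto
    then have "det M = 0"
      using M by (simp add: det_transpose)
    then obtain v where v: "v \<in> carrier_vec n" "v \<noteq> 0\<^sub>v n" "M *\<^sub>v v = 0\<^sub>v n"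
      using det_0_iff_vec_prod_zero_field[OF M] by blast
    \<comment> \<open>As \<open>y\<close> annihilates the columns of \<open>V\<close>, it reads off
      the last coordinate of the kernel vector \<open>v\<close>. That coordinate vanishes, and the
      rest is a kernel vector of the injective \<open>V\<close>.\<close>
    have "M\<^sup>T *\<^sub>v y = (a \<bullet> y) \<cdot>\<^sub>v unit_vec n m"
      using M orth[OF _ Wy] m by (auto intro!: eq_vecI simp: col_M unit_vec_def)
    moreover have "(M\<^sup>T *\<^sub>v y) \<bullet> v = 0"
      using transpose_vec_mult_scalar[OF M v(1) y(1)] v y by simp
    ultimately have "v $ m = 0"
      using ay v m by auto
    have "V *\<^sub>v vec_first v m = M *\<^sub>v v"
    proof (rule eq_vecI)
      show "(V *\<^sub>v vec_first v m) $ k = (M *\<^sub>v v) $ k" if "k < dim_vec (M *\<^sub>v v)" for k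
        using that M V v(1) m \<open>v $ m = 0\<close>
        by (auto simp: scalar_prod_def vec_first_def M_def)
    qed (use M V in auto)
    then have "vec_first v m = 0\<^sub>v m"
      using inj[of "vec_first v m"] v by simp
    then have "vec_first v m $ k = 0" if "k < m" for k
      using that by simp
    then have "v $ k = 0" if "k < n" for k
      using that \<open>v $ m = 0\<close> m by (cases "k = m") (auto simp: vec_first_def)
    then show False
      using v by auto
  qed
  then have "x = (x $ i / q $ i) \<cdot>\<^sub>v q"
    using x q unfolding y_def by (intro eq_vecI) (auto simp: vec_eq_iff)
  then show ?thesis
    by blast
qed

lemma mult_mat_vec_surj:
  fixes N :: "'a :: field mat"
  assumes N: "N \<in> carrier_mat n n" "det N \<noteq> 0" and y: "y \<in> carrier_vec n"
  obtains v where "v \<in> carrier_vec n" "N *\<^sub>v v = y"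
proof
  have adj: "adj_mat N *\<^sub>v y \<in> carrier_vec n"
    using mult_mat_vec_carrier[OF adj_mat(1)[OF N(1)] y] .
  then show "(1 / det N) \<cdot>\<^sub>v (adj_mat N *\<^sub>v y) \<in> carrier_vec n"
    by simp
  have "N *\<^sub>v (adj_mat N *\<^sub>v y) = (N * adj_mat N) *\<^sub>v y"
    using assoc_mult_mat_vec[OF N(1) adj_mat(1)[OF N(1)] y] by simp
  also have "\<dots> = det N \<cdot>\<^sub>v y"
    unfolding adj_mat(2)[OF N(1)] using y by (auto intro!: eq_vecI)
  finally show "N *\<^sub>v ((1 / det N) \<cdot>\<^sub>v (adj_mat N *\<^sub>v y)) = y"
    using N y adj by (auto simp: mult_mat_vec[OF N(1)] smult_smult_assoc)
qed

text \<open>Fredholm alternative with the same vector on both sides: the image lies in the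
  hyperplane orthogonal to \<open>q\<close>, and a kernel contained in a line makes it fill this
  hyperplane.\<close>

lemma image_of_corank_one:
  fixes M :: "'a :: field mat"
  assumes M: "M \<in> carrier_mat n n"
    and q: "q \<in> carrier_vec n" "q \<noteq> 0\<^sub>v n" "M\<^sup>T *\<^sub>v q = 0\<^sub>v n"
    and ker: "\<And>v. v \<in> carrier_vec n \<Longrightarrow> M *\<^sub>v v = 0\<^sub>v n \<Longrightarrow> \<exists>c. v = c \<cdot>\<^sub>v q"
    and y: "y \<in> carrier_vec n" "q \<bullet> y = 0"
  shows "\<exists>v \<in> carrier_vec n. M *\<^sub>v v = y"
proof -
  obtain j where j: "j < n" "q $ j \<noteq> 0"
    using q by (metis eq_vecI carrier_vecD index_zero_vec)
  \<comment> \<open>a rank-one perturbation that is invertible and agrees with \<open>M\<close> wherever its values are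
    orthogonal to \<open>q\<close>\<close>
  define N where "N = M + mat n n (\<lambda>(k, l). if k = j \<and> l = j then 1 else 0)"
  have N: "N \<in> carrier_mat n n"
    using M by (simp add: N_def)
  have N_mult: "N *\<^sub>v v = M *\<^sub>v v + (v $ j) \<cdot>\<^sub>v unit_vec n j" if "v \<in> carrier_vec n" for v
  proof -
    have "mat n n (\<lambda>(k, l). if k = j \<and> l = j then 1 else 0) *\<^sub>v v = (v $ j) \<cdot>\<^sub>v unit_vec n j"
      using that j by (auto intro!: eq_vecI simp: scalar_prod_def unit_vec_def if_distrib[of "\<lambda>x. x * _"] cong: if_cong)
    then show ?thesis
      unfolding N_def using that M by (subst add_mult_distrib_mat_vec[of _ n n]) auto
  qed
  have q_N: "q \<bullet> (N *\<^sub>v v) = v $ j * q $ j" if v: "v \<in> carrier_vec n" for v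
  proof -
    have "q \<bullet> (M *\<^sub>v v) = 0"
      using transpose_vec_mult_scalar[OF M v q(1)] q v by simp
    then show ?thesis
      unfolding N_mult[OF v] using M v q j
      by (subst scalar_prod_add_distrib[of _ n]) auto
  qed
  have M_of_N: "M *\<^sub>v v = N *\<^sub>v v" if v: "v \<in> carrier_vec n" and "q \<bullet> (N *\<^sub>v v) = 0" for v
    using q_N[OF v] that j M unfolding N_mult[OF v] by (auto intro!: eq_vecI)
  have "det N \<noteq> 0"
  proof
    assume "det N = 0"
    then obtain v where v: "v \<in> carrier_vec n" "v \<noteq> 0\<^sub>v n" "N *\<^sub>v v = 0\<^sub>v n"
      using det_0_iff_vec_prod_zero_field[OF N] by blast
    have "M *\<^sub>v v = 0\<^sub>v n"
      using M_of_N[OF v(1)] v q by simp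
    then obtain c where c: "v = c \<cdot>\<^sub>v q"
      using ker[OF v(1)] by blast
    have "v $ j = 0"
      using q_N[OF v(1)] v(3) q j by simp
    then show False
      using c j q v by auto
  qed
  then obtain v where v: "v \<in> carrier_vec n" "N *\<^sub>v v = y"
    using mult_mat_vec_surj[OF N _ y(1)] by blast
  then show ?thesis
    using M_of_N[OF v(1)] y by auto
qed

section \<open>Walks of a symmetric matrix and the bordered eigenvector system\<close>

lemma pow_mat_Suc_left:
  fixes A :: "'a :: semiring_1 mat"
  assumes A: "A \<in> carrier_mat n n"
  shows "A ^\<^sub>m Suc k = A * A ^\<^sub>m k"
proof (induction k)
  case 0
  then show ?case using A by simp
next
  case (Suc k)
  have "A ^\<^sub>m Suc (Suc k) = (A * A ^\<^sub>m k) * A"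
    using Suc by simp
  also have "\<dots> = A * A ^\<^sub>m Suc k"
    using A by (simp add: assoc_mult_mat[of A n n "A ^\<^sub>m k" n A n])
  finally show ?case .
qed

lemma pow_mat_Suc_mult_vec:
  fixes A :: "'a :: comm_semiring_1 mat"
  assumes A: "A \<in> carrier_mat n n" and b: "b \<in> carrier_vec n"
  shows "A ^\<^sub>m Suc k *\<^sub>v b = A *\<^sub>v (A ^\<^sub>m k *\<^sub>v b)"
  unfolding pow_mat_Suc_left[OF A]
  by (rule assoc_mult_mat_vec[OF A _ b]) (use A in simp)

lemma symmetric_pow_scalar_prod_Suc:
  fixes A :: "'a :: comm_semiring_1 mat"
  assumes A: "A \<in> carrier_mat n n" "A\<^sup>T = A"
    and b: "b \<in> carrier_vec n" and x: "x \<in> carrier_vec n"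
  shows "(A ^\<^sub>m Suc k *\<^sub>v b) \<bullet> x = (A ^\<^sub>m k *\<^sub>v b) \<bullet> (A *\<^sub>v x)"
proof -
  have "A ^\<^sub>m k *\<^sub>v b \<in> carrier_vec n"
    using A(1) by (intro mult_mat_vec_carrier[of _ n n] b) auto
  then show ?thesis
    unfolding pow_mat_Suc_mult_vec[OF A(1) b]
    using transpose_vec_mult_scalar[OF A(1) x] A(2) by simp
qed

text \<open>This is \<open>image_of_corank_one\<close> for \<open>A - ev I\<close> bordered by the
  column \<open>q\<close> and the row \<open>b\<close>. The vector \<open>(q, 0)\<close> is in the
  left kernel because \<open>q\<close> is an isotropic eigenvector of a symmetric matrix, and it
  spans the right kernel by \<open>ker\<close>. So \<open>q \<bullet> y = 0\<close> is the only
  obstruction and \<open>c\<close> is free.\<close>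

lemma bordered_system_solvable:
  fixes A :: "'a :: field mat"
  assumes A: "A \<in> carrier_mat n n" "A\<^sup>T = A"
    and b: "b \<in> carrier_vec n"
    and q: "q \<in> carrier_vec n" "q \<noteq> 0\<^sub>v n" "q \<bullet> q = 0" "b \<bullet> q = 0" "A *\<^sub>v q = ev \<cdot>\<^sub>v q"
    and ker: "\<And>x. x \<in> carrier_vec n \<Longrightarrow> (\<And>k. (A ^\<^sub>m k *\<^sub>v b) \<bullet> x = 0) \<Longrightarrow> \<exists>c. x = c \<cdot>\<^sub>v q"
    and y: "y \<in> carrier_vec n" "q \<bullet> y = 0"
  shows "\<exists>g \<in> carrier_vec n. \<exists>t. A *\<^sub>v g - ev \<cdot>\<^sub>v g + t \<cdot>\<^sub>v q = y \<and> b \<bullet> g = c"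
proof -
  define D where "D = A - ev \<cdot>\<^sub>m 1\<^sub>m n"
  define P where "P = mat n 1 (\<lambda>(i, j). q $ i)"
  define R where "R = mat 1 n (\<lambda>(i, j). b $ j)"
  define M where "M = four_block_mat D P R (0\<^sub>m 1 1)"
  have D: "D \<in> carrier_mat n n" and P: "P \<in> carrier_mat n 1" and R: "R \<in> carrier_mat 1 n"
    using A by (auto simp: D_def P_def R_def)
  have M: "M \<in> carrier_mat (n + 1) (n + 1)"
    using D by (auto simp: M_def)
  have D_sym: "D\<^sup>T = D"
  proof (rule eq_matI)
    fix i j
    assume ij: "i < dim_row D" "j < dim_col D"
    then have "A $$ (j, i) = A $$ (i, j)"
      using A(1) D by (subst (2) A(2)[symmetric]) auto
    then show "D\<^sup>T $$ (i, j) = D $$ (i, j)"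
      using ij A(1) D by (auto simp: D_def)
  qed (use D in auto)
  have D_mult: "D *\<^sub>v x = A *\<^sub>v x - ev \<cdot>\<^sub>v x" if x: "x \<in> carrier_vec n" for x
    unfolding D_def using A x
    by (subst minus_mult_distrib_mat_vec[of _ n n]) (auto intro!: eq_vecI)
  have P_mult: "P *\<^sub>v s = (s $ 0) \<cdot>\<^sub>v q" if s: "s \<in> carrier_vec 1" for s
    using s q by (auto intro!: eq_vecI simp: P_def scalar_prod_def)
  have R_mult: "R *\<^sub>v x = vec 1 (\<lambda>_. b \<bullet> x)" if x: "x \<in> carrier_vec n" for x
    using x b by (auto intro!: eq_vecI simp: R_def scalar_prod_def)
  have zero_mult: "0\<^sub>m 1 1 *\<^sub>v s = 0\<^sub>v 1" if "s \<in> carrier_vec 1" for s :: "'a vec"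
    using that by (auto intro!: eq_vecI)
  have M_mult: "M *\<^sub>v (x @\<^sub>v s) = (D *\<^sub>v x + P *\<^sub>v s) @\<^sub>v (R *\<^sub>v x)"
    if x: "x \<in> carrier_vec n" and s: "s \<in> carrier_vec 1" for x s
    unfolding M_def using four_block_mat_mult_vec[OF D P R zero_carrier_mat x s] R x s zero_mult[OF s] by simp
  have split: "v = vec_first v n @\<^sub>v vec_last v 1" if "v \<in> carrier_vec (n + 1)" for v :: "'a vec"
    using that by simp
  have zero_split: "0\<^sub>v (n + 1) = (0\<^sub>v n @\<^sub>v 0\<^sub>v 1 :: 'a vec)"
    by (auto intro!: eq_vecI simp: append_vec_def)
  have "\<exists>v \<in> carrier_vec (n + 1). M *\<^sub>v v = y @\<^sub>v vec 1 (\<lambda>_. c)"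
  proof (rule image_of_corank_one[OF M, where q = "q @\<^sub>v 0\<^sub>v 1"])
    show "q @\<^sub>v 0\<^sub>v 1 \<in> carrier_vec (n + 1)"
      by (rule append_carrier_vec[OF q(1) zero_carrier_vec])
    show "q @\<^sub>v 0\<^sub>v 1 \<noteq> 0\<^sub>v (n + 1)"
      using q unfolding zero_split by (subst append_vec_eq[of _ n]) auto
    have "D *\<^sub>v q = 0\<^sub>v n"
      using D_mult[OF q(1)] q by simp
    moreover have "P\<^sup>T *\<^sub>v q = 0\<^sub>v 1"
      using q by (auto intro!: eq_vecI simp: P_def scalar_prod_def)
    moreover have "M\<^sup>T = four_block_mat D R\<^sup>T P\<^sup>T (0\<^sub>m 1 1)"
      unfolding M_def using transpose_four_block_mat[OF D P R, of "0\<^sub>m 1 1"] D_sym by simp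
    moreover have "R\<^sup>T *\<^sub>v 0\<^sub>v 1 = 0\<^sub>v n"
      using R by (auto intro!: eq_vecI)
    ultimately show "M\<^sup>T *\<^sub>v (q @\<^sub>v 0\<^sub>v 1) = 0\<^sub>v (n + 1)"
      unfolding zero_split
      using four_block_mat_mult_vec[OF D, of "R\<^sup>T" 1 "P\<^sup>T" 1 "0\<^sub>m 1 1" q "0\<^sub>v 1"] P R q
        zero_mult[OF zero_carrier_vec] by simp
    show "y @\<^sub>v vec 1 (\<lambda>_. c) \<in> carrier_vec (n + 1)"
      by (rule append_carrier_vec[OF y(1) vec_carrier])
    show "(q @\<^sub>v 0\<^sub>v 1) \<bullet> (y @\<^sub>v vec 1 (\<lambda>_. c)) = 0"
      using q y by (subst scalar_prod_append[of _ n _ 1]) auto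
  next
    fix v
    assume v: "v \<in> carrier_vec (n + 1)" and Mv: "M *\<^sub>v v = 0\<^sub>v (n + 1)"
    define g where "g = vec_first v n"
    define s where "s = vec_last v 1"
    have g: "g \<in> carrier_vec n" and s: "s \<in> carrier_vec 1" and vgs: "v = g @\<^sub>v s"
      using split[OF v] by (auto simp: g_def s_def)
    have "D *\<^sub>v g + P *\<^sub>v s = 0\<^sub>v n \<and> R *\<^sub>v g = 0\<^sub>v 1"
      using Mv D P g s unfolding vgs M_mult[OF g s] zero_split
      by (subst (asm) append_vec_eq[of _ n]) auto
    then have 1: "D *\<^sub>v g + (s $ 0) \<cdot>\<^sub>v q = 0\<^sub>v n" and 2: "b \<bullet> g = 0"
      using P_mult[OF s] R_mult[OF g] by (auto simp: vec_eq_iff)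
    have Ag: "A *\<^sub>v g = ev \<cdot>\<^sub>v g - (s $ 0) \<cdot>\<^sub>v q"
    proof (rule eq_vecI)
      fix i
      assume "i < dim_vec (ev \<cdot>\<^sub>v g - (s $ 0) \<cdot>\<^sub>v q)"
      then have i: "i < n"
        using q by simp
      have "(D *\<^sub>v g + (s $ 0) \<cdot>\<^sub>v q) $ i = 0"
        unfolding 1 using i by simp
      then show "(A *\<^sub>v g) $ i = (ev \<cdot>\<^sub>v g - (s $ 0) \<cdot>\<^sub>v q) $ i"
        unfolding D_mult[OF g] using i A g q
        by (simp add: algebra_simps add_eq_0_iff del: index_mult_mat_vec)
    qed (use A q in auto)
    have walk: "A ^\<^sub>m k *\<^sub>v b \<in> carrier_vec n" for k
      using A(1) by (intro mult_mat_vec_carrier[of _ n n] b) auto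
    have q_walk: "(A ^\<^sub>m k *\<^sub>v b) \<bullet> q = 0" for k
    proof (induction k)
      case 0
      then show ?case using A b q by simp
    next
      case (Suc k)
      then show ?case
        using symmetric_pow_scalar_prod_Suc[OF A b q(1), of k] q walk[of k]
        by (simp add: scalar_prod_smult_distrib[of _ n])
    qed
    \<comment> \<open>Moving one factor \<open>A\<close> onto \<open>g\<close> produces multiples of
      \<open>g\<close> and \<open>q\<close>. Both pair to zero with the preceding walk vector, so
      \<open>ker\<close> puts \<open>g\<close> on the line of \<open>q\<close>.\<close>
    have "(A ^\<^sub>m k *\<^sub>v b) \<bullet> g = 0" for k
    proof (induction k)
      case 0
      then show ?case using A b 2 by simp
    next
      case (Suc k)
      then show ?case
        using symmetric_pow_scalar_prod_Suc[OF A b g, of k] q_walk[of k] q g walk[of k]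
        unfolding Ag by (simp add: scalar_prod_minus_distrib[of _ n] scalar_prod_smult_distrib[of _ n])
    qed
    then obtain c' where c': "g = c' \<cdot>\<^sub>v q"
      using ker[OF g] by blast
    have "D *\<^sub>v g = 0\<^sub>v n"
      unfolding c' using D q D_mult[OF q(1)] by (auto simp: mult_mat_vec[OF D])
    then have "(s $ 0) \<cdot>\<^sub>v q = 0\<^sub>v n"
      using 1 q by simp
    then have "s = 0\<^sub>v 1"
      using q s by (auto simp: vec_eq_iff)
    then show "\<exists>c. v = c \<cdot>\<^sub>v (q @\<^sub>v 0\<^sub>v 1)"
      unfolding vgs c' by (intro exI[of _ c'] eq_vecI) (auto simp: append_vec_def Let_def)
  qed
  then obtain v where v: "v \<in> carrier_vec (n + 1)" and Mv: "M *\<^sub>v v = y @\<^sub>v vec 1 (\<lambda>_. c)"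
    by blast
  define g where "g = vec_first v n"
  define s where "s = vec_last v 1"
  have g: "g \<in> carrier_vec n" and s: "s \<in> carrier_vec 1" and vgs: "v = g @\<^sub>v s"
    using split[OF v] by (auto simp: g_def s_def)
  have "D *\<^sub>v g + P *\<^sub>v s = y \<and> R *\<^sub>v g = vec 1 (\<lambda>_. c)"
    using Mv D P g s y unfolding vgs M_mult[OF g s]
    by (subst (asm) append_vec_eq[of _ n]) auto
  then have "A *\<^sub>v g - ev \<cdot>\<^sub>v g + (s $ 0) \<cdot>\<^sub>v q = y" "b \<bullet> g = c"
    using P_mult[OF s] R_mult[OF g] D_mult[OF g] by (auto simp: vec_eq_iff)
  then show ?thesis
    using g by blast
qed

section \<open>Characteristic polynomials and walks modulo 2\<close>

text \<open>Multiples of the characteristic polynomial are allowed because odd order later needs an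
  extra factor \<open>x\<close>. Comparing coefficients in \<open>(x I - A) N = p I\<close>, with
  \<open>N\<close> a multiple of the adjugate, gives \<open>p_k I = N_(k-1) - A N_k\<close>;
  multiplying by \<open>A^k\<close> makes the sum telescope.\<close>

lemma cayley_hamilton_entries:
  fixes A :: "'a :: comm_ring_1 mat"
  assumes A: "A \<in> carrier_mat n n" and p: "char_poly A dvd p" and ij: "i < n" "j < n"
  shows "(\<Sum>k\<le>degree p. Polynomial.coeff p k * (A ^\<^sub>m k) $$ (i, j)) = 0"
proof -
  obtain u where u: "p = char_poly A * u"
    using p by (elim dvdE)
  define C where "C = char_poly_matrix A"
  have C: "C \<in> carrier_mat n n"
    using A by (simp add: C_def)
  define N where "N = u \<cdot>\<^sub>m adj_mat C"
  have N: "N \<in> carrier_mat n n"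
    using adj_mat(1)[OF C] by (simp add: N_def)
  have "C * N = u \<cdot>\<^sub>m (C * adj_mat C)"
    unfolding N_def by (rule mult_smult_distrib[OF C adj_mat(1)[OF C]])
  then have CN: "C * N = p \<cdot>\<^sub>m 1\<^sub>m n"
    unfolding adj_mat(2)[OF C] u by (auto intro!: eq_matI simp: C_def char_poly_def)
  define N' where "N' k = map_mat (\<lambda>a. Polynomial.coeff a k) N" for k
  define S where "S k = (if k = 0 then 0\<^sub>m n n else N' (k - 1))" for k
  have N': "N' k \<in> carrier_mat n n" and S: "S k \<in> carrier_mat n n" for k
    using N by (auto simp: N'_def S_def)
  have eq: "Polynomial.coeff p k \<cdot>\<^sub>m 1\<^sub>m n = S k - A * N' k" for k
  proof (rule eq_matI)
    fix a b
    assume "a < dim_row (S k - A * N' k)" "b < dim_col (S k - A * N' k)"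
    then have ab: "a < n" "b < n"
      using A N'[of k] by auto
    have C_entry: "C $$ (a, l) = (if a = l then [:0, 1:] else 0) - [:A $$ (a, l):]" if "l < n" for l
      using that ab A by (auto simp: C_def char_poly_matrix_def)
    have "(C * N) $$ (a, b) = (\<Sum>l<n. C $$ (a, l) * N $$ (l, b))"
      using C N ab by (auto simp: scalar_prod_def atLeast0LessThan)
    also have "\<dots> = (\<Sum>l<n. (if a = l then [:0, 1:] * N $$ (l, b) else 0) - [:A $$ (a, l):] * N $$ (l, b))"
      by (intro sum.cong refl) (auto simp: C_entry algebra_simps)
    also have "\<dots> = [:0, 1:] * N $$ (a, b) - (\<Sum>l<n. [:A $$ (a, l):] * N $$ (l, b))"
      using ab by (simp add: sum_subtractf)
    finally have "Polynomial.coeff ((C * N) $$ (a, b)) k =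
        Polynomial.coeff (pCons 0 (N $$ (a, b))) k - (\<Sum>l<n. A $$ (a, l) * Polynomial.coeff (N $$ (l, b)) k)"
      by (simp add: coeff_sum)
    also have "\<dots> = (S k - A * N' k) $$ (a, b)"
      using A N' N ab by (cases k) (auto simp: S_def N'_def scalar_prod_def atLeast0LessThan)
    finally show "(Polynomial.coeff p k \<cdot>\<^sub>m 1\<^sub>m n) $$ (a, b) = (S k - A * N' k) $$ (a, b)"
      unfolding CN using ab by (auto split: if_splits)
  qed (use A N'[of k] in auto)
  define F where "F k = (A ^\<^sub>m k * S k) $$ (i, j)" for k
  have F: "Polynomial.coeff p k * (A ^\<^sub>m k) $$ (i, j) = F k - F (Suc k)" for k
  proof -
    have Ak: "A ^\<^sub>m k \<in> carrier_mat n n"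
      using A by simp
    have "Polynomial.coeff p k \<cdot>\<^sub>m A ^\<^sub>m k = A ^\<^sub>m k * (Polynomial.coeff p k \<cdot>\<^sub>m 1\<^sub>m n)"
      by (simp only: mult_smult_distrib[OF Ak one_carrier_mat] right_mult_one_mat[OF Ak])
    also have "\<dots> = A ^\<^sub>m k * S k - A ^\<^sub>m k * (A * N' k)"
      unfolding eq by (rule mult_minus_distrib_mat[OF Ak S]) (use A N' in auto)
    also have "A ^\<^sub>m k * (A * N' k) = A ^\<^sub>m Suc k * S (Suc k)"
      using assoc_mult_mat[OF Ak A N', of k] by (simp add: S_def)
    finally have "(Polynomial.coeff p k \<cdot>\<^sub>m A ^\<^sub>m k) $$ (i, j) = F k - F (Suc k)"
      unfolding F_def using ij mult_carrier_mat[OF Ak S[of k]]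
        mult_carrier_mat[OF pow_carrier_mat[OF A, of "Suc k"] S[of "Suc k"]]
        A S[of "Suc k"] by (simp del: pow_mat.simps index_mult_mat(1))
    then show ?thesis
      using ij Ak A by simp
  qed
  \<comment> \<open>Large enough that coefficient \<open>d + 1\<close> of every entry of
    \<open>N\<close> vanishes, and at least \<open>degree p\<close>, so that extending the sum only
    adds zeros.\<close>
  define d where "d = degree p + (\<Sum>a<n. \<Sum>b<n. degree (N $$ (a, b)))"
  have "degree (N $$ (a, b)) \<le> d" if "a < n" "b < n" for a b
  proof -
    have "degree (N $$ (a, b)) \<le> (\<Sum>b<n. degree (N $$ (a, b)))"
      using that by (intro member_le_sum) auto
    also have "\<dots> \<le> (\<Sum>a<n. \<Sum>b<n. degree (N $$ (a, b)))"
      using that by (intro member_le_sum[where f = "\<lambda>a. \<Sum>b<n. degree (N $$ (a, b))"]) auto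
    finally show ?thesis
      by (simp add: d_def)
  qed
  then have "N' (Suc d) = 0\<^sub>m n n"
    using N by (auto intro!: eq_matI coeff_eq_0 simp: N'_def less_Suc_eq_le)
  then have F_end: "F (Suc (Suc d)) = 0"
    using ij A by (simp add: F_def S_def right_mult_zero_mat[of _ n n])
  have F_0: "F 0 = 0"
    using ij A by (simp add: F_def S_def)
  have "(\<Sum>k\<le>degree p. Polynomial.coeff p k * (A ^\<^sub>m k) $$ (i, j)) = (\<Sum>k<Suc (Suc d). Polynomial.coeff p k * (A ^\<^sub>m k) $$ (i, j))"
    by (intro sum.mono_neutral_left) (auto simp: d_def coeff_eq_0)
  also have "\<dots> = (\<Sum>k<Suc (Suc d). F k - F (Suc k))"
    by (simp only: F)
  also have "\<dots> = F 0 - F (Suc (Suc d))"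
    by (rule sum_lessThan_telescope')
  finally show ?thesis
    using F_0 F_end by simp
qed

text \<open>Substituting \<open>-x\<close> into \<open>det (x I - A)\<close> gives
  \<open>(-1)^n\<close> times the characteristic polynomial of \<open>- A = A\<^sup>T\<close>, which
  is that of \<open>A\<close>. A coefficient of the wrong parity is thus its own negative, and
  characteristic zero kills it.\<close>

lemma char_poly_skew_symmetric_coeff:
  fixes A :: "'a :: {idom, ring_char_0} mat"
  assumes A: "A \<in> carrier_mat n n" "A\<^sup>T = - A" and k: "odd (n + k)"
  shows "Polynomial.coeff (char_poly A) k = 0"
proof -
  let ?h = "\<lambda>q :: 'a poly. q \<circ>\<^sub>p [:0, -1:]"
  have eq: "map_mat ?h (char_poly_matrix A) = (-1) \<cdot>\<^sub>m char_poly_matrix (- A)"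
    using A(1) by (intro eq_matI) (auto simp: char_poly_matrix_def pcompose_pCons pcompose_diff pcompose_add)
  have "?h (char_poly A) = det (map_mat ?h (char_poly_matrix A))"
    by (simp add: char_poly_def comm_ring_hom.hom_det[OF pcompose_hom.comm_ring_hom_axioms])
  also have "\<dots> = (-1) ^ n * char_poly (- A)"
    unfolding eq using carrier_matD(2)[OF char_poly_matrix_closed[of "- A" n]] A(1)
    by (simp add: char_poly_def)
  also have "char_poly (- A) = char_poly A"
    using char_poly_transpose_mat[OF A(1)] A(2) by simp
  finally have "Polynomial.coeff (?h (char_poly A)) k = Polynomial.coeff ((-1) ^ n * char_poly A) k"
    by simp
  then have "(-1) ^ k * Polynomial.coeff (char_poly A) k = (-1) ^ n * Polynomial.coeff (char_poly A) k"
    by (cases "even n") (auto simp: coeff_pcompose_linear)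
  then show ?thesis
    using k by (cases "even n") (auto simp: eq_neg_iff_add_eq_0 neg_eq_iff_add_eq_0)
qed

text \<open>Modulo 2 a symmetric matrix with zero diagonal is the reduction of a skew-symmetric one.\<close>

lemma char_poly_symmetric_coeff_char_2:
  fixes A :: "int mat"
  assumes A: "A \<in> carrier_mat n n" "A\<^sup>T = A" "\<And>i. i < n \<Longrightarrow> A $$ (i, i) = 0"
    and char: "CHAR('a :: field) = 2" and k: "odd (n + k)"
  shows "Polynomial.coeff (char_poly (map_mat of_int A :: 'a mat)) k = 0"
proof -
  define K where "K = mat n n (\<lambda>(i, j). if i < j then A $$ (i, j) else - A $$ (i, j))"
  have K: "K \<in> carrier_mat n n"
    by (simp add: K_def)
  have sym: "A $$ (j, i) = A $$ (i, j)" if "i < n" "j < n" for i j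
    using that A(1) by (subst (2) A(2)[symmetric]) auto
  have "K\<^sup>T = - K"
  proof (rule eq_matI)
    fix i j
    assume "i < dim_row (- K)" "j < dim_col (- K)"
    then have "i < n" "j < n"
      using K by auto
    then show "K\<^sup>T $$ (i, j) = (- K) $$ (i, j)"
      using A(3) sym[of i j] by (cases i j rule: linorder_cases) (auto simp: K_def)
  qed (use K in auto)
  then have "Polynomial.coeff (char_poly K) k = 0"
    using char_poly_skew_symmetric_coeff[OF K _ k] by blast
  moreover have "map_mat of_int A = (map_mat of_int K :: 'a mat)"
    using A(1) uminus_CHAR_2[OF char] by (intro eq_matI) (auto simp: K_def)
  ultimately show ?thesis
    using of_int_hom.char_poly_hom[OF K, where ?'a = 'a] by simp
qed

section \<open>The recurrence of walk vectors when squaring is the identity\<close>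

lemma pow_mat_add:
  fixes A :: "'a :: semiring_1 mat"
  assumes A: "A \<in> carrier_mat n n"
  shows "A ^\<^sub>m (k + l) = A ^\<^sub>m k * A ^\<^sub>m l"
proof (induction l)
  case 0
  have "A ^\<^sub>m k \<in> carrier_mat n n"
    using A by simp
  then show ?case
    using A by simp
next
  case (Suc l)
  then show ?case
    using A assoc_mult_mat[of "A ^\<^sub>m k" n n "A ^\<^sub>m l" n A n] by simp
qed

lemma transpose_pow_mat:
  fixes A :: "'a :: comm_semiring_1 mat"
  assumes A: "A \<in> carrier_mat n n"
  shows "(A ^\<^sub>m k)\<^sup>T = A\<^sup>T ^\<^sub>m k"
proof (induction k)
  case 0
  then show ?case using A by simp
next
  case (Suc k)
  have "(A ^\<^sub>m Suc k)\<^sup>T = A\<^sup>T * (A ^\<^sub>m k)\<^sup>T"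
    using A by (simp add: transpose_mult[of _ n n _ n])
  then show ?case
    using Suc A pow_mat_Suc_left[of "A\<^sup>T" n k] by simp
qed

text \<open>By symmetry a diagonal entry of \<open>A^(2k)\<close> is the sum of the squares of a row
  of \<open>A^k\<close>; idempotence removes the squares and leaves a row sum.\<close>

lemma pow_mat_all_one_vec_idempotent:
  fixes A :: "'a :: comm_ring_1 mat"
  assumes A: "A \<in> carrier_mat n n" "A\<^sup>T = A" and idem: "\<And>x :: 'a. x * x = x" and j: "j < n"
  shows "(A ^\<^sub>m k *\<^sub>v all_one_vec n) $ j = (A ^\<^sub>m (2 * k)) $$ (j, j)"
proof -
  have Ak: "A ^\<^sub>m k \<in> carrier_mat n n"
    using A by simp
  have sym: "(A ^\<^sub>m k) $$ (l, j) = (A ^\<^sub>m k) $$ (j, l)" if "l < n" for l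
    using transpose_pow_mat[OF A(1), of k] Ak that j unfolding A(2)
    by (metis index_transpose_mat(1) carrier_matD)
  have "(A ^\<^sub>m (2 * k)) $$ (j, j) = (\<Sum>l<n. (A ^\<^sub>m k) $$ (j, l) * (A ^\<^sub>m k) $$ (l, j))"
    unfolding mult_2 pow_mat_add[OF A(1)]
    using A(1) j by (auto simp: scalar_prod_def atLeast0LessThan)
  also have "\<dots> = (\<Sum>l<n. (A ^\<^sub>m k) $$ (j, l))"
    by (intro sum.cong refl) (simp add: sym idem)
  also have "\<dots> = (A ^\<^sub>m k *\<^sub>v all_one_vec n) $ j"
    using A(1) j by (auto simp: scalar_prod_def atLeast0LessThan all_one_vec_def)
  finally show ?thesis ..
qed

lemma sum_even_indices:
  fixes f :: "nat \<Rightarrow> 'a :: comm_monoid_add"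
  assumes "\<And>k. odd k \<Longrightarrow> f k = 0"
  shows "(\<Sum>k\<le>2 * r. f k) = (\<Sum>i\<le>r. f (2 * i))"
  by (induction r) (use assms in auto)

text \<open>Reading Cayley-Hamilton on the diagonal halves every exponent: a polynomial of degree
  \<open>2 * r\<close> with even powers only becomes a relation among the first \<open>r + 1\<close>
  walk vectors, which multiplication by \<open>A^m\<close> shifts.\<close>

lemma pow_mat_all_one_vec_recurrence:
  fixes A :: "'a :: comm_ring_1 mat"
  assumes A: "A \<in> carrier_mat n n" "A\<^sup>T = A" and idem: "\<And>x :: 'a. x * x = x"
    and p: "char_poly A dvd p" "degree p = 2 * r" "Polynomial.coeff p (2 * r) = 1"
      "\<And>k. odd k \<Longrightarrow> Polynomial.coeff p k = 0"
    and j: "j < n"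
  shows "(A ^\<^sub>m (m + r) *\<^sub>v all_one_vec n) $ j =
    (\<Sum>i<r. - Polynomial.coeff p (2 * i) * (A ^\<^sub>m (m + i) *\<^sub>v all_one_vec n) $ j)"
proof -
  let ?e = "all_one_vec n :: 'a vec"
  have e: "?e \<in> carrier_vec n"
    by (simp add: all_one_vec_def)
  have walk: "A ^\<^sub>m k *\<^sub>v ?e \<in> carrier_vec n" for k
    using A(1) by (intro mult_mat_vec_carrier[of _ n n] e) auto
  have zero: "(\<Sum>i\<le>r. Polynomial.coeff p (2 * i) * (A ^\<^sub>m i *\<^sub>v ?e) $ l) = 0" if l: "l < n" for l
  proof -
    have "(\<Sum>i\<le>r. Polynomial.coeff p (2 * i) * (A ^\<^sub>m i *\<^sub>v ?e) $ l) =
        (\<Sum>i\<le>r. Polynomial.coeff p (2 * i) * (A ^\<^sub>m (2 * i)) $$ (l, l))"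
      by (intro sum.cong refl) (simp only: pow_mat_all_one_vec_idempotent[OF A idem l])
    also have "\<dots> = (\<Sum>k\<le>2 * r. Polynomial.coeff p k * (A ^\<^sub>m k) $$ (l, l))"
      by (rule sum_even_indices[symmetric]) (simp add: p)
    also have "\<dots> = 0"
      using cayley_hamilton_entries[OF A(1) p(1) l l] p(2) by simp
    finally show ?thesis .
  qed
  have "(A ^\<^sub>m (m + i) *\<^sub>v ?e) $ j = (\<Sum>l<n. (A ^\<^sub>m m) $$ (j, l) * (A ^\<^sub>m i *\<^sub>v ?e) $ l)" for i
  proof -
    have "A ^\<^sub>m (m + i) *\<^sub>v ?e = A ^\<^sub>m m *\<^sub>v (A ^\<^sub>m i *\<^sub>v ?e)"
      unfolding pow_mat_add[OF A(1)]
      by (rule assoc_mult_mat_vec[of _ n n _ n]) (use A e in auto)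
    then show ?thesis
      using walk[of i] A(1) j by (simp add: scalar_prod_def[of _ "A ^\<^sub>m i *\<^sub>v ?e"] atLeast0LessThan)
  qed
  then have "(\<Sum>i\<le>r. Polynomial.coeff p (2 * i) * (A ^\<^sub>m (m + i) *\<^sub>v ?e) $ j) =
      (\<Sum>i\<le>r. \<Sum>l<n. (A ^\<^sub>m m) $$ (j, l) * (Polynomial.coeff p (2 * i) * (A ^\<^sub>m i *\<^sub>v ?e) $ l))"
    by (simp add: sum_distrib_left mult_ac del: index_mult_mat_vec)
  also have "\<dots> = (\<Sum>l<n. (A ^\<^sub>m m) $$ (j, l) * (\<Sum>i\<le>r. Polynomial.coeff p (2 * i) * (A ^\<^sub>m i *\<^sub>v ?e) $ l))"
    by (subst sum.swap) (simp add: sum_distrib_left del: index_mult_mat_vec)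
  also have "\<dots> = 0"
    by (simp add: zero del: index_mult_mat_vec)
  finally have "(\<Sum>i<r. Polynomial.coeff p (2 * i) * (A ^\<^sub>m (m + i) *\<^sub>v ?e) $ j) + (A ^\<^sub>m (m + r) *\<^sub>v ?e) $ j = 0"
    using p(3) by (simp add: lessThan_Suc_atMost[symmetric] del: index_mult_mat_vec)
  then show ?thesis
    by (simp add: sum_negf add_eq_0_iff del: index_mult_mat_vec)
qed

text \<open>The coefficients \<open>g\<close> are fixed before the sequence \<open>u\<close>: they
  depend on the recurrence alone, so that one choice serves the walks of two different
  matrices.\<close>

lemma linear_recurrence_coefficients:
  fixes f :: "nat \<Rightarrow> 'a :: comm_ring_1"
  shows "\<exists>g. \<forall>u. (\<forall>m. u (m + r) = (\<Sum>i<r. f i * u (m + i))) \<longrightarrow> (\<forall>m. u m = (\<Sum>i<r. g m i * u i))"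
proof -
  let ?rec = "\<lambda>u. \<forall>m. u (m + r) = (\<Sum>i<r. f i * u (m + i))"
  have "\<exists>h. \<forall>u. ?rec u \<longrightarrow> u m = (\<Sum>i<r. h i * u i)" for m
  proof (induction m rule: less_induct)
    case (less m)
    show ?case
    proof (cases "m < r")
      case True
      then have "u m = (\<Sum>i<r. (if i = m then 1 else 0) * u i)" for u :: "nat \<Rightarrow> 'a"
        by (simp add: if_distrib[of "\<lambda>x. x * _"] cong: if_cong)
      then show ?thesis
        by (intro exI[of _ "\<lambda>i. if i = m then 1 else 0"]) blast
    next
      case False
      define k where "k = m - r"
      have m: "m = k + r"
        using False by (simp add: k_def)
      have "\<forall>i. \<exists>h. i < r \<longrightarrow> (\<forall>u. ?rec u \<longrightarrow> u (k + i) = (\<Sum>l<r. h l * u l))"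
        using less by (simp add: m)
      then obtain h where h: "\<And>i u. i < r \<Longrightarrow> ?rec u \<Longrightarrow> u (k + i) = (\<Sum>l<r. h i l * u l)"
        by metis
      have "u m = (\<Sum>l<r. (\<Sum>i<r. f i * h i l) * u l)" if "?rec u" for u
      proof -
        have "u m = (\<Sum>i<r. f i * u (k + i))"
          using that unfolding m by blast
        also have "\<dots> = (\<Sum>i<r. \<Sum>l<r. f i * h i l * u l)"
          by (intro sum.cong refl) (simp add: h[OF _ that] sum_distrib_left mult.assoc)
        also have "\<dots> = (\<Sum>l<r. (\<Sum>i<r. f i * h i l) * u l)"
          by (subst sum.swap) (simp add: sum_distrib_right)
        finally show ?thesis .
      qed
      then show ?thesis
        by (intro exI[of _ "\<lambda>l. \<Sum>i<r. f i * h i l"]) blast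
    qed
  qed
  then have "\<forall>m. \<exists>h. \<forall>u. ?rec u \<longrightarrow> u m = (\<Sum>i<r. h i * u i)"
    by blast
  from choice[OF this] show ?thesis
    by blast
qed

text \<open>With \<open>U\<close> the first \<open>r\<close> columns and \<open>G\<close> the
  coefficients that express \<open>r\<close> independent columns through them,
  \<open>V = U G\<close> is injective. So the square matrix \<open>G\<close> is invertible, and a
  relation \<open>a = G v\<close> of \<open>U\<close> gives \<open>V v = 0\<close>, hence
  \<open>v = 0\<close> and \<open>a = 0\<close>.\<close>

lemma spanning_columns_independent:
  fixes W :: "'a :: field mat"
  assumes W: "W \<in> carrier_mat n m" and rank: "vec_space.rank n W = r" and r: "r \<le> m"
    and span: "\<And>j k. j < n \<Longrightarrow> k < m \<Longrightarrow> W $$ (j, k) = (\<Sum>i<r. g k i * W $$ (j, i))"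
    and zero: "\<And>j. j < n \<Longrightarrow> (\<Sum>i<r. a i * W $$ (j, i)) = 0"
    and i: "i < r"
  shows "a i = 0"
proof -
  obtain V where V: "V \<in> carrier_mat n r" "set (cols V) \<subseteq> set (cols W)"
    and inj: "\<And>v. v \<in> carrier_vec r \<Longrightarrow> V *\<^sub>v v = 0\<^sub>v n \<Longrightarrow> v = 0\<^sub>v r"
    using linear_independent_columns_of_rank[OF W rank] by blast
  have "\<forall>l. \<exists>k. l < r \<longrightarrow> k < m \<and> col V l = col W k"
  proof (intro allI)
    fix l
    show "\<exists>k. l < r \<longrightarrow> k < m \<and> col V l = col W k"
    proof (cases "l < r")
      case True
      then have "col V l \<in> set (cols W)"
        using V by (auto simp: cols_def)
      then show ?thesis
        using W by (auto simp: cols_def)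
    qed simp
  qed
  then obtain c where c: "\<And>l. l < r \<Longrightarrow> c l < m \<and> col V l = col W (c l)"
    by metis
  define U where "U = mat n r (\<lambda>(j, i). W $$ (j, i))"
  define G where "G = mat r r (\<lambda>(i, l). g (c l) i)"
  have U: "U \<in> carrier_mat n r" and G: "G \<in> carrier_mat r r"
    by (auto simp: U_def G_def)
  have VUG: "V = U * G"
  proof (rule eq_matI)
    fix j l
    assume "j < dim_row (U * G)" "l < dim_col (U * G)"
    then have jl: "j < n" "l < r"
      using U G by auto
    have "V $$ (j, l) = col V l $ j"
      using jl V(1) by simp
    also have "\<dots> = W $$ (j, c l)"
      using c[OF jl(2)] jl W by simp
    also have "\<dots> = (U * G) $$ (j, l)"
      using span[OF jl(1), of "c l"] c[OF jl(2)] jl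
      by (simp add: U_def G_def scalar_prod_def atLeast0LessThan mult.commute)
    finally show "V $$ (j, l) = (U * G) $$ (j, l)" .
  qed (use V(1) U G in auto)
  have V_mult: "V *\<^sub>v v = U *\<^sub>v (G *\<^sub>v v)" if "v \<in> carrier_vec r" for v
    unfolding VUG using assoc_mult_mat_vec[OF U G that] .
  have "det G \<noteq> 0"
  proof
    assume "det G = 0"
    then obtain v where v: "v \<in> carrier_vec r" "v \<noteq> 0\<^sub>v r" "G *\<^sub>v v = 0\<^sub>v r"
      using det_0_iff_vec_prod_zero_field[OF G] by blast
    have "U *\<^sub>v 0\<^sub>v r = 0\<^sub>v n"
      using U by (auto intro!: eq_vecI)
    then show False
      using inj[OF v(1)] V_mult[OF v(1)] v by simp
  qed
  then obtain v where v: "v \<in> carrier_vec r" "G *\<^sub>v v = vec r a"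
    using mult_mat_vec_surj[OF G, of "vec r a"] by auto
  have "V *\<^sub>v v = 0\<^sub>v n"
    unfolding V_mult[OF v(1)] v(2)
    using zero by (auto intro!: eq_vecI simp: U_def scalar_prod_def atLeast0LessThan mult.commute)
  moreover have "G *\<^sub>v 0\<^sub>v r = 0\<^sub>v r"
    using G by (auto intro!: eq_vecI)
  ultimately have "vec r a = 0\<^sub>v r"
    using inj[OF v(1)] v(2) by simp
  then show ?thesis
    using i by (metis index_vec index_zero_vec(1))
qed

section \<open>Reduction modulo a prime\<close>

lemma of_int_mod_ring_eq_0_iff:
  "(of_int x :: 'p :: nontriv mod_ring) = 0 \<longleftrightarrow> int CARD('p) dvd x"
  using of_int_eq_iff_cong_CHAR[of x 0, where 'a = "'p mod_ring"] by (simp add: cong_0_iff)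

lemma vec_eq_0_mod_ring:
  fixes v :: "int vec"
  assumes "v \<in> carrier_vec n" "map_vec of_int v = (0\<^sub>v n :: 'p :: nontriv mod_ring vec)"
  obtains u where "u \<in> carrier_vec n" "v = int CARD('p) \<cdot>\<^sub>v u"
proof
  show "map_vec (\<lambda>x. x div int CARD('p)) v \<in> carrier_vec n"
    using assms(1) by simp
  have "int CARD('p) dvd v $ i" if "i < n" for i
  proof -
    have "(of_int (v $ i) :: 'p mod_ring) = map_vec of_int v $ i"
      using assms(1) that by simp
    then show ?thesis
      using assms(2) that by (simp add: of_int_mod_ring_eq_0_iff)
  qed
  then show "v = int CARD('p) \<cdot>\<^sub>v map_vec (\<lambda>x. x div int CARD('p)) v"
    using assms(1) by (intro eq_vecI) auto
qed

lemma vec_of_int_mod_ring_surj: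
  fixes v :: "'p :: nontriv mod_ring vec"
  assumes "v \<in> carrier_vec n"
  obtains u where "u \<in> carrier_vec n" "map_vec of_int u = v"
proof
  show "map_vec to_int_mod_ring v \<in> carrier_vec n"
    using assms by simp
  show "map_vec of_int (map_vec to_int_mod_ring v) = v"
    using assms by (intro eq_vecI) (auto simp: of_int_of_int_mod_ring)
qed

lemma (in comm_ring_hom) scalar_prod_hom:
  assumes "v \<in> carrier_vec n" "w \<in> carrier_vec n"
  shows "map_vec hom v \<bullet> map_vec hom w = hom (v \<bullet> w)"
  using assms by (simp add: scalar_prod_def hom_distribs)

text \<open>The library's \<open>mult_mat_vec\<close> is stated for fields only.\<close>

lemma mult_mat_smult_vec:
  fixes A :: "'a :: comm_ring mat"
  assumes "A \<in> carrier_mat nr nc" "v \<in> carrier_vec nc"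
  shows "A *\<^sub>v (k \<cdot>\<^sub>v v) = k \<cdot>\<^sub>v (A *\<^sub>v v)"
  using assms by (auto intro!: eq_vecI)

text \<open>In the application \<open>R = d Q\<close>, \<open>B = Q\<^sup>T A Q\<close> and
  \<open>b\<close> is the all-one vector; the hypotheses on \<open>R\<close> are similarity,
  orthogonality and regularity of \<open>Q\<close> with the denominators cleared.\<close>

lemma corank_one_divisible:
  fixes A B R X W :: "int mat" and b :: "int vec"
  defines "p \<equiv> int CARD('p :: prime_card)"
  assumes A: "A \<in> carrier_mat n n" "A\<^sup>T = A"
    and B: "B \<in> carrier_mat n n" "\<And>i. i < n \<Longrightarrow> B $$ (i, i) = 0"
    and b: "b \<in> carrier_vec n"
    and W: "W = mat_of_cols n (map (\<lambda>k. A ^\<^sub>m k *\<^sub>v b) [0..<n])"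
    and n: "n \<ge> 1" and rank: "rank_mod TYPE('p) W = n - 1"
    and X: "X \<in> carrier_mat n n" "W * X = d \<cdot>\<^sub>m 1\<^sub>m n"
    and d: "d \<noteq> 0" "p dvd d"
    and R: "R \<in> carrier_mat n n" "A * R = R * B" "R\<^sup>T * R = d\<^sup>2 \<cdot>\<^sub>m 1\<^sub>m n" "R\<^sup>T *\<^sub>v b = d \<cdot>\<^sub>v b"
    and ij: "i < n" "j < n"
  shows "p dvd R $$ (i, j)"
proof (rule ccontr)
  assume not_dvd: "\<not> p dvd R $$ (i, j)"
  let ?red = "map_vec of_int :: int vec \<Rightarrow> 'p mod_ring vec"
  let ?A = "map_mat of_int A :: 'p mod_ring mat"
  have prime: "prime p"
    unfolding p_def by (rule prime_card_int)
  have red_0: "(of_int x :: 'p mod_ring) = 0 \<longleftrightarrow> p dvd x" for x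
    unfolding p_def by (rule of_int_mod_ring_eq_0_iff)
  define q where "q = col R j"
  have q: "q \<in> carrier_vec n" "q $ i = R $$ (i, j)"
    using R ij by (auto simp: q_def)
  define k where "k = multiplicity p d"
  obtain d' where d': "d = p ^ k * d'" "\<not> p dvd d'"
    using multiplicity_decompose'[of d p] d(1) prime unfolding k_def
    by (metis not_prime_unit)
  have k: "k \<ge> 1"
    using d(2) d' by (cases k) auto
  define w where "w l = A ^\<^sub>m l *\<^sub>v b" for l
  have w: "w l \<in> carrier_vec n" for l
    unfolding w_def using A(1) by (intro mult_mat_vec_carrier[of _ n n] b) auto
  have w_Suc: "w (Suc l) \<bullet> x = w l \<bullet> (A *\<^sub>v x)" if "x \<in> carrier_vec n" for l x
    unfolding w_def by (rule symmetric_pow_scalar_prod_Suc[OF A b that])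
  have Wc: "W \<in> carrier_mat n n"
    by (rule carrier_matI) (simp_all add: W)
  have W_T: "W\<^sup>T *\<^sub>v x = vec n (\<lambda>l. w l \<bullet> x)" for x
  proof (rule eq_vecI)
    fix l
    assume "l < dim_vec (vec n (\<lambda>l. w l \<bullet> x))"
    then show "(W\<^sup>T *\<^sub>v x) $ l = vec n (\<lambda>l. w l \<bullet> x) $ l"
      using w[of l] by (simp add: W w_def)
  qed (simp add: W)

  \<comment> \<open>\<open>R\<^sup>T\<close> intertwines \<open>A\<close> with
    \<open>B\<^sup>T\<close>, so the factor \<open>d\<close> in \<open>R\<^sup>T b = d b\<close>
    passes to every walk vector. Hence all walk vectors pair with \<open>q\<close> to multiples of
    \<open>d\<close>.\<close>
  have RT_w: "\<exists>z \<in> carrier_vec n. R\<^sup>T *\<^sub>v w l = d \<cdot>\<^sub>v z" for l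
  proof (induction l)
    case 0
    have "w 0 = b"
      using A(1) b by (simp add: w_def)
    then show ?case
      using R b by auto
  next
    case (Suc l)
    then obtain z where z: "z \<in> carrier_vec n" "R\<^sup>T *\<^sub>v w l = d \<cdot>\<^sub>v z"
      by blast
    have "R\<^sup>T *\<^sub>v w (Suc l) = R\<^sup>T *\<^sub>v (A *\<^sub>v w l)"
      unfolding w_def pow_mat_Suc_mult_vec[OF A(1) b] ..
    also have "\<dots> = (R\<^sup>T * A\<^sup>T) *\<^sub>v w l"
      using A R(1) w by (simp add: assoc_mult_mat_vec[of _ n n _ n])
    also have "R\<^sup>T * A\<^sup>T = B\<^sup>T * R\<^sup>T"
      using R(1,2) A(1) B(1) by (metis transpose_mult)
    also have "(B\<^sup>T * R\<^sup>T) *\<^sub>v w l = B\<^sup>T *\<^sub>v (d \<cdot>\<^sub>v z)"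
      using B(1) R(1) w[of l] by (simp add: assoc_mult_mat_vec[of _ n n _ n] z(2))
    also have "\<dots> = d \<cdot>\<^sub>v (B\<^sup>T *\<^sub>v z)"
      by (rule mult_mat_smult_vec[OF _ z(1)]) (use B(1) in simp)
    finally show ?case
      using mult_mat_vec_carrier[of "B\<^sup>T" n n z] B(1) z(1) by auto
  qed
  have w_q: "d dvd w l \<bullet> q" for l
  proof -
    obtain z where z: "z \<in> carrier_vec n" "R\<^sup>T *\<^sub>v w l = d \<cdot>\<^sub>v z"
      using RT_w by blast
    have "w l \<bullet> q = (R\<^sup>T *\<^sub>v w l) $ j"
      using R(1) ij w[of l] q(1) by (simp add: q_def comm_scalar_prod[of _ n])
    then show ?thesis
      using z ij by simp
  qed
  have b_q: "b \<bullet> q = d * b $ j"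
  proof -
    have "b \<bullet> q = (R\<^sup>T *\<^sub>v b) $ j"
      using R(1) ij b q(1) by (simp add: q_def comm_scalar_prod[of _ n])
    then show ?thesis
      unfolding R(4) using b ij by simp
  qed
  have q_q: "q \<bullet> q = d\<^sup>2"
  proof -
    have "q \<bullet> q = (R\<^sup>T * R) $$ (j, j)"
      using R(1) ij by (simp add: q_def)
    then show ?thesis
      unfolding R(3) using ij by simp
  qed
  \<comment> \<open>This is \<open>d^2\<close> times a diagonal entry of \<open>B\<close>, which is
    zero.\<close>
  have q_A_q: "q \<bullet> (A *\<^sub>v q) = 0"
  proof -
    have "q \<bullet> (A *\<^sub>v q) = (R\<^sup>T * (A * R)) $$ (j, j)"
      using R(1) A(1) ij by (simp add: q_def mult_mat_vec_def)
    also have "R\<^sup>T * (A * R) = (R\<^sup>T * R) * B"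
      unfolding R(2) using R(1) B(1) by (simp add: assoc_mult_mat[of _ n n _ n _ n])
    also have "\<dots> = d\<^sup>2 \<cdot>\<^sub>m B"
      unfolding R(3) using B(1) by (simp add: mult_smult_assoc_mat[of _ n n _ n])
    finally show ?thesis
      using B ij by simp
  qed

  have red_w: "?red (w l) = ?A ^\<^sub>m l *\<^sub>v ?red b" for l
    unfolding w_def using A(1) b
    by (simp add: of_int_hom.mult_mat_vec_hom[of _ n n] of_int_hom.mat_hom_pow[of _ n])
  have red_scalar: "?red x \<bullet> ?red y = of_int (x \<bullet> y)" if "x \<in> carrier_vec n" "y \<in> carrier_vec n" for x y
    using of_int_hom.scalar_prod_hom[OF that] .
  have red_W_T: "(map_mat of_int W)\<^sup>T *\<^sub>v x = vec n (\<lambda>l. ?red (w l) \<bullet> x)"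
    if x: "x \<in> carrier_vec n" for x :: "'p mod_ring vec"
  proof -
    obtain y where y: "y \<in> carrier_vec n" "?red y = x"
      using vec_of_int_mod_ring_surj[OF x] by blast
    have "(map_mat of_int W)\<^sup>T *\<^sub>v x = ?red (W\<^sup>T *\<^sub>v y)"
      using Wc y by (simp add: of_int_hom.mult_mat_vec_hom[of _ n n] map_mat_transpose)
    then show ?thesis
      unfolding W_T using y w by (auto intro!: eq_vecI simp: red_scalar)
  qed
  have red_q: "?red q \<in> carrier_vec n" "?red q \<noteq> 0\<^sub>v n"
  proof -
    show "?red q \<in> carrier_vec n"
      using q(1) by simp
    have "?red q $ i \<noteq> 0"
      using q ij not_dvd by (simp add: red_0)
    then show "?red q \<noteq> 0\<^sub>v n"
      using ij by auto
  qed
  have red_w_q: "?red (w l) \<bullet> ?red q = 0" for l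
    using w_q[of l] d(2) w q(1) by (auto simp: red_scalar red_0 intro: dvd_trans)
  have ker: "\<exists>c. x = c \<cdot>\<^sub>v ?red q"
    if "x \<in> carrier_vec n" "\<And>l. l < n \<Longrightarrow> ?red (w l) \<bullet> x = 0" for x :: "'p mod_ring vec"
  proof (rule left_kernel_of_corank_one[of "map_mat of_int W" n])
    show "vec_space.rank n (map_mat of_int W :: 'p mod_ring mat) = n - 1"
      using rank Wc by (simp add: rank_mod_def)
    show "(map_mat of_int W)\<^sup>T *\<^sub>v ?red q = 0\<^sub>v n"
      using red_W_T[OF red_q(1)] red_w_q by auto
    show "(map_mat of_int W)\<^sup>T *\<^sub>v x = 0\<^sub>v n"
      using red_W_T[OF that(1)] that(2) by auto
  qed (use Wc n red_q that in auto)
  have ker_int: "\<exists>c u. u \<in> carrier_vec n \<and> x = c \<cdot>\<^sub>v q + p \<cdot>\<^sub>v u"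
    if x: "x \<in> carrier_vec n" and dvd: "\<And>l. p dvd w l \<bullet> x" for x
  proof -
    have "?red (w l) \<bullet> ?red x = 0" for l
      using dvd[of l] w x by (simp add: red_scalar red_0)
    then obtain c' where c': "?red x = c' \<cdot>\<^sub>v ?red q"
      using ker[of "?red x"] x by auto
    define c where "c = to_int_mod_ring c'"
    have c: "of_int c = c'"
      by (simp add: c_def of_int_of_int_mod_ring)
    have "(of_int (x $ a) :: 'p mod_ring) = of_int c * of_int (q $ a)" if "a < n" for a
      using arg_cong[OF c', of "\<lambda>v. v $ a"] x q(1) that c by simp
    then have "?red (x - c \<cdot>\<^sub>v q) = 0\<^sub>v n"
      using x q(1) by (auto intro!: eq_vecI)
    then obtain u where "u \<in> carrier_vec n" "x - c \<cdot>\<^sub>v q = p \<cdot>\<^sub>v u"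
      using vec_eq_0_mod_ring[of "x - c \<cdot>\<^sub>v q" n] x q(1) unfolding p_def by auto
    moreover from this(2) have "x = c \<cdot>\<^sub>v q + p \<cdot>\<^sub>v u"
      using x q(1) by (auto simp: vec_eq_iff algebra_simps)
    ultimately show ?thesis
      by blast
  qed

  \<comment> \<open>Induction on the precision: while \<open>m < k\<close>, the error
    \<open>p^m \<beta>\<close> pairs with the walk vectors to multiples of \<open>d\<close>. So
    \<open>\<beta>\<close> is orthogonal to them modulo \<open>p\<close>, is a multiple of
    \<open>q\<close> modulo \<open>p\<close>, and is absorbed into the eigenvalue.\<close>
  have "\<exists>ev \<beta>. \<beta> \<in> carrier_vec n \<and> A *\<^sub>v q = ev \<cdot>\<^sub>v q + p ^ m \<cdot>\<^sub>v \<beta>" if "m \<le> k" for m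
    using that
  proof (induction m)
    case 0
    have "A *\<^sub>v q = 0 \<cdot>\<^sub>v q + p ^ 0 \<cdot>\<^sub>v (A *\<^sub>v q)"
      using A(1) q(1) by (auto intro!: eq_vecI)
    then show ?case
      using mult_mat_vec_carrier[OF A(1) q(1)] by blast
  next
    case (Suc m)
    then obtain ev \<beta> where \<beta>: "\<beta> \<in> carrier_vec n" and Aq: "A *\<^sub>v q = ev \<cdot>\<^sub>v q + p ^ m \<cdot>\<^sub>v \<beta>"
      by auto
    have "p dvd w l \<bullet> \<beta>" for l
    proof -
      have "w (Suc l) \<bullet> q = ev * (w l \<bullet> q) + p ^ m * (w l \<bullet> \<beta>)"
        using w_Suc[OF q(1), of l] w[of l] q(1) \<beta> unfolding Aq
        by (simp add: scalar_prod_add_distrib[of _ n])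
      then have "p ^ m * (w l \<bullet> \<beta>) = w (Suc l) \<bullet> q - ev * (w l \<bullet> q)"
        by simp
      then have "d dvd p ^ m * (w l \<bullet> \<beta>)"
        using w_q by simp
      moreover have "p ^ Suc m dvd d"
        unfolding d' using Suc.prems by (meson dvd_mult2 le_imp_power_dvd)
      ultimately have "p ^ m * p dvd p ^ m * (w l \<bullet> \<beta>)"
        by (metis dvd_trans power_Suc2)
      then show ?thesis
        using prime by (simp add: prime_gt_0_int)
    qed
    then obtain c u where u: "u \<in> carrier_vec n" "\<beta> = c \<cdot>\<^sub>v q + p \<cdot>\<^sub>v u"
      using ker_int[OF \<beta>] by blast
    have "A *\<^sub>v q = (ev + p ^ m * c) \<cdot>\<^sub>v q + p ^ Suc m \<cdot>\<^sub>v u"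
      unfolding Aq u(2) using u(1) q(1) by (auto intro!: eq_vecI simp: algebra_simps)
    then show ?case
      using u(1) by blast
  qed
  then obtain ev \<beta> where \<beta>: "\<beta> \<in> carrier_vec n" and Aq: "A *\<^sub>v q = ev \<cdot>\<^sub>v q + p ^ k \<cdot>\<^sub>v \<beta>"
    by blast
  \<comment> \<open>Since \<open>q \<bullet> A q = 0\<close> and \<open>q \<bullet> q = d^2\<close>
    carries \<open>p^(2k)\<close>, cancelling \<open>p^k\<close> leaves \<open>p^k\<close> in
    \<open>q \<bullet> \<beta>\<close>. This is the solvability condition of the bordered
    system.\<close>
  have q_\<beta>: "p dvd q \<bullet> \<beta>"
  proof -
    have "ev * d\<^sup>2 + p ^ k * (q \<bullet> \<beta>) = 0"
      using q_A_q q(1) \<beta> q_q unfolding Aq by (simp add: scalar_prod_add_distrib[of _ n])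
    then have "p ^ k * (ev * p ^ k * d'\<^sup>2 + q \<bullet> \<beta>) = 0"
      unfolding d' by (simp add: algebra_simps power2_eq_square)
    then have "q \<bullet> \<beta> = - (ev * p ^ k * d'\<^sup>2)"
      using prime by (simp add: prime_gt_0_int add_eq_0_iff)
    moreover have "p dvd p ^ k"
      using k by (simp add: dvd_power)
    ultimately show ?thesis
      by simp
  qed

  \<comment> \<open>The value \<open>d' * b $ j\<close> is the one for which \<open>p^k g\<close>
    cancels \<open>b \<bullet> q = d * b $ j\<close> modulo \<open>p^(k+1)\<close>; the multiplier
    \<open>t\<close> becomes the correction of the eigenvalue.\<close>
  have "\<exists>g \<in> carrier_vec n. \<exists>t. ?A *\<^sub>v g - of_int ev \<cdot>\<^sub>v g + t \<cdot>\<^sub>v ?red q = ?red \<beta> \<and>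
      ?red b \<bullet> g = of_int (d' * b $ j)"
  proof (rule bordered_system_solvable)
    show "?A\<^sup>T = ?A"
      using A(2) by (simp add: map_mat_transpose)
    have "?A *\<^sub>v ?red q = ?red (A *\<^sub>v q)"
      by (rule of_int_hom.mult_mat_vec_hom[OF A(1) q(1), symmetric])
    also have "\<dots> = of_int ev \<cdot>\<^sub>v ?red q"
      unfolding Aq using q(1) \<beta> k red_0[of p] by (auto intro!: eq_vecI simp: zero_power)
    finally show "?A *\<^sub>v ?red q = of_int ev \<cdot>\<^sub>v ?red q" .
    show "?red q \<bullet> ?red q = 0" "?red b \<bullet> ?red q = 0" "?red q \<bullet> ?red \<beta> = 0"
      using q(1) b \<beta> q_\<beta> d(2) by (auto simp: red_scalar red_0 q_q b_q)
    show "\<exists>c. x = c \<cdot>\<^sub>v ?red q" if "x \<in> carrier_vec n" "\<And>l. (?A ^\<^sub>m l *\<^sub>v ?red b) \<bullet> x = 0" for x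
      using ker[OF that(1)] that(2) by (simp add: red_w)
  qed (use A(1) b red_q \<beta> in auto)
  then obtain g' t' where g': "g' \<in> carrier_vec n"
    and g'1: "?A *\<^sub>v g' - of_int ev \<cdot>\<^sub>v g' + t' \<cdot>\<^sub>v ?red q = ?red \<beta>"
    and g'2: "?red b \<bullet> g' = of_int (d' * b $ j)"
    by blast
  obtain g where g: "g \<in> carrier_vec n" "?red g = g'"
    using vec_of_int_mod_ring_surj[OF g'] by blast
  define t where "t = to_int_mod_ring t'"
  have t: "of_int t = t'"
    by (simp add: t_def of_int_of_int_mod_ring)
  have Ag: "A *\<^sub>v g \<in> carrier_vec n"
    using mult_mat_vec_carrier[OF A(1) g(1)] .
  have "?A *\<^sub>v g' = ?red (A *\<^sub>v g)"
    unfolding g(2)[symmetric] by (rule of_int_hom.mult_mat_vec_hom[OF A(1) g(1), symmetric])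
  then have "?red (A *\<^sub>v g - ev \<cdot>\<^sub>v g + t \<cdot>\<^sub>v q - \<beta>) = ?A *\<^sub>v g' - of_int ev \<cdot>\<^sub>v g' + t' \<cdot>\<^sub>v ?red q - ?red \<beta>"
    using A(1) Ag g q(1) \<beta> t by (auto intro!: eq_vecI simp del: index_mult_mat_vec)
  also have "\<dots> = 0\<^sub>v n"
    unfolding g'1 using \<beta> by (auto intro!: eq_vecI)
  finally obtain \<delta> where \<delta>: "\<delta> \<in> carrier_vec n" "A *\<^sub>v g - ev \<cdot>\<^sub>v g + t \<cdot>\<^sub>v q - \<beta> = p \<cdot>\<^sub>v \<delta>"
    using vec_eq_0_mod_ring[of "A *\<^sub>v g - ev \<cdot>\<^sub>v g + t \<cdot>\<^sub>v q - \<beta>" n] Ag g(1) q(1) \<beta>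
    unfolding p_def by auto
  have "(of_int (b \<bullet> g - d' * b $ j) :: 'p mod_ring) = 0"
    using g'2 unfolding g(2)[symmetric] red_scalar[OF b g(1)] by simp
  then obtain \<epsilon> where \<epsilon>: "b \<bullet> g - d' * b $ j = p * \<epsilon>"
    unfolding red_0 by (elim dvdE)
  define x where "x = q - p ^ k \<cdot>\<^sub>v g"
  have x: "x \<in> carrier_vec n"
    using q(1) g(1) by (simp add: x_def)
  \<comment> \<open>The remainder at precision \<open>p^(k+1)\<close>: the cross term
    \<open>p^(2k) t g\<close> has this factor because \<open>k \<ge> 1\<close>.\<close>
  define \<zeta> where "\<zeta> = (p ^ (k - 1) * t) \<cdot>\<^sub>v g - \<delta>"
  have \<zeta>: "\<zeta> \<in> carrier_vec n"
    using g(1) \<delta>(1) by (simp add: \<zeta>_def)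
  have Ax: "A *\<^sub>v x = (ev + p ^ k * t) \<cdot>\<^sub>v x + p ^ Suc k \<cdot>\<^sub>v \<zeta>"
  proof (rule eq_vecI)
    fix l
    assume "l < dim_vec ((ev + p ^ k * t) \<cdot>\<^sub>v x + p ^ Suc k \<cdot>\<^sub>v \<zeta>)"
    then have l: "l < n"
      using \<zeta> by simp
    have "(A *\<^sub>v g - ev \<cdot>\<^sub>v g + t \<cdot>\<^sub>v q - \<beta>) $ l = p * \<delta> $ l"
      unfolding \<delta>(2) using l \<delta>(1) by simp
    then have Agl: "(A *\<^sub>v g) $ l = ev * g $ l - t * q $ l + \<beta> $ l + p * \<delta> $ l"
      using l Ag g(1) q(1) \<beta> by (simp del: index_mult_mat_vec)
    have Aql: "(A *\<^sub>v q) $ l = ev * q $ l + p ^ k * \<beta> $ l"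
      unfolding Aq using l q(1) \<beta> by simp
    have "A *\<^sub>v x = A *\<^sub>v q - p ^ k \<cdot>\<^sub>v (A *\<^sub>v g)"
      unfolding x_def mult_mat_smult_vec[OF A(1) g(1), symmetric]
      using A(1) q(1) g(1) by (intro mult_minus_distrib_mat_vec[of _ n n]) auto
    then have "(A *\<^sub>v x) $ l = (A *\<^sub>v q) $ l - p ^ k * (A *\<^sub>v g) $ l"
      using l Ag A(1) q(1) by (simp del: index_mult_mat_vec)
    also have "\<dots> = ev * (q $ l - p ^ k * g $ l) + p ^ k * t * q $ l - p ^ Suc k * \<delta> $ l"
      unfolding Agl Aql by (simp add: algebra_simps)
    also have "\<dots> = (ev + p ^ k * t) * (q $ l - p ^ k * g $ l) +
        p ^ Suc k * (p ^ (k - 1) * t * g $ l - \<delta> $ l)"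
    proof -
      have "p ^ k = p * p ^ (k - 1)"
        using k by (cases k) auto
      then show ?thesis
        by (simp add: algebra_simps)
    qed
    finally show "(A *\<^sub>v x) $ l = ((ev + p ^ k * t) \<cdot>\<^sub>v x + p ^ Suc k \<cdot>\<^sub>v \<zeta>) $ l"
      using l q(1) g(1) \<delta>(1) by (simp add: x_def \<zeta>_def)
  qed (use A(1) \<zeta> in auto)
  have w_x: "p ^ Suc k dvd w l \<bullet> x" for l
  proof (induction l)
    case 0
    have "w 0 \<bullet> x = b \<bullet> q - p ^ k * (b \<bullet> g)"
      using A(1) b q(1) g(1) by (simp add: w_def x_def scalar_prod_minus_distrib[of _ n])
    also have "b \<bullet> g = d' * b $ j + p * \<epsilon>"
      using \<epsilon> by simp
    also have "b \<bullet> q - p ^ k * (d' * b $ j + p * \<epsilon>) = p ^ Suc k * (- \<epsilon>)"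
      unfolding b_q d' by (simp add: algebra_simps)
    finally show ?case
      by (metis dvd_triv_left)
  next
    case (Suc l)
    have "w (Suc l) \<bullet> x = (ev + p ^ k * t) * (w l \<bullet> x) + p ^ Suc k * (w l \<bullet> \<zeta>)"
      unfolding w_Suc[OF x] Ax using w[of l] x \<zeta> by (simp add: scalar_prod_add_distrib[of _ n])
    then show ?case
      using Suc by (metis dvd_add dvd_mult dvd_triv_left)
  qed
  define y where "y = vec n (\<lambda>l. (w l \<bullet> x) div p ^ Suc k)"
  have y: "y \<in> carrier_vec n" "W\<^sup>T *\<^sub>v x = p ^ Suc k \<cdot>\<^sub>v y"
    unfolding W_T y_def using w_x by (auto intro!: eq_vecI simp del: power_Suc)
  \<comment> \<open>\<open>p^(k+1)\<close> divides \<open>d x\<close> with only \<open>p^k\<close>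
    in \<open>d\<close>, so \<open>p\<close> divides \<open>x $ i\<close> and with it
    \<open>q $ i\<close>, against the choice of \<open>i\<close> and \<open>j\<close>.\<close>
  have "d \<cdot>\<^sub>v x = (W * X)\<^sup>T *\<^sub>v x"
    unfolding X(2) using x by (auto intro!: eq_vecI)
  also have "\<dots> = X\<^sup>T *\<^sub>v (W\<^sup>T *\<^sub>v x)"
    using Wc X(1) x by (simp add: transpose_mult[of _ n n _ n] assoc_mult_mat_vec[of _ n n _ n])
  also have "\<dots> = p ^ Suc k \<cdot>\<^sub>v (X\<^sup>T *\<^sub>v y)"
    unfolding y(2) by (rule mult_mat_smult_vec[OF _ y(1)]) (use X(1) in simp)
  finally have "(d \<cdot>\<^sub>v x) $ i = (p ^ Suc k \<cdot>\<^sub>v (X\<^sup>T *\<^sub>v y)) $ i"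
    by simp
  then have "d * x $ i = p ^ Suc k * (X\<^sup>T *\<^sub>v y) $ i"
    using ij x X(1) by simp
  then have "p ^ k * (d' * x $ i) = p ^ k * (p * (X\<^sup>T *\<^sub>v y) $ i)"
    unfolding d' by (simp add: mult_ac)
  then have "p dvd d' * x $ i"
    using prime by (simp add: prime_gt_0_int)
  then have "p dvd x $ i"
    using prime d'(2) by (simp add: prime_dvd_mult_iff)
  moreover have "p dvd p ^ k * g $ i"
    using k by (simp add: dvd_power)
  moreover have "q $ i = x $ i + p ^ k * g $ i"
    using ij q(1) g(1) by (simp add: x_def)
  ultimately show False
    using not_dvd q(2) by (metis dvd_add)
qed

section \<open>Relations among walk vectors shared by two matrices\<close>

lemma mat_of_walk_mult:
  fixes A X :: "'a :: comm_semiring_1 mat"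
  assumes A: "A \<in> carrier_mat n n" and b: "b \<in> carrier_vec n" and X: "X \<in> carrier_mat n n"
    and ij: "i < n" "j < n"
  shows "(mat_of_cols n (map (\<lambda>k. A ^\<^sub>m k *\<^sub>v b) [0..<n]) * X) $$ (i, j) =
    (\<Sum>k<n. X $$ (k, j) * (A ^\<^sub>m k *\<^sub>v b) $ i)"
proof -
  have "(mat_of_cols n (map (\<lambda>k. A ^\<^sub>m k *\<^sub>v b) [0..<n])) $$ (i, k) = (A ^\<^sub>m k *\<^sub>v b) $ i"
    if "k < n" for k
    using that ij by (simp add: mat_of_cols_index)
  then show ?thesis
    using ij X A
    by (simp add: scalar_prod_def atLeast0LessThan mult.commute del: index_mult_mat_vec)
qed

text \<open>The common multiple \<open>p\<close> gives both families the same recurrence, hence the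
  same coefficients \<open>g\<close> over the first \<open>r\<close> walk vectors. A relation
  \<open>c\<close> collapses to one relation \<open>a\<close> on those; independence for
  \<open>A\<close> forces \<open>a = 0\<close>, and then the relation holds for
  \<open>B\<close>.\<close>

lemma walk_kernel_subset:
  fixes A B :: "'a :: field mat"
  assumes A: "A \<in> carrier_mat n n" "A\<^sup>T = A" and B: "B \<in> carrier_mat n n" "B\<^sup>T = B"
    and idem: "\<And>x :: 'a. x * x = x"
    and p: "char_poly A dvd p" "char_poly B dvd p" "degree p = 2 * r" "Polynomial.coeff p (2 * r) = 1"
      "\<And>k. odd k \<Longrightarrow> Polynomial.coeff p k = 0"
    and rank: "vec_space.rank n (mat_of_cols n (map (\<lambda>k. A ^\<^sub>m k *\<^sub>v all_one_vec n) [0..<n])) = r"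
    and zero: "\<And>j. j < n \<Longrightarrow> (\<Sum>k<n. c k * (A ^\<^sub>m k *\<^sub>v all_one_vec n) $ j) = 0"
    and j: "j < n"
  shows "(\<Sum>k<n. c k * (B ^\<^sub>m k *\<^sub>v all_one_vec n) $ j) = 0"
proof -
  define W where "W = mat_of_cols n (map (\<lambda>k. A ^\<^sub>m k *\<^sub>v all_one_vec n) [0..<n])"
  have W: "W \<in> carrier_mat n n"
    by (rule carrier_matI) (simp_all add: W_def)
  have W_index: "W $$ (i, k) = (A ^\<^sub>m k *\<^sub>v all_one_vec n) $ i" if "i < n" "k < n" for i k
    using that by (simp add: W_def mat_of_cols_index)
  have r: "r \<le> n"
    using vec_space.rank_le_nc[OF W] rank by (simp add: W_def)
  obtain g where "\<And>u. (\<forall>m. u (m + r) = (\<Sum>i<r. - Polynomial.coeff p (2 * i) * u (m + i))) \<Longrightarrow>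
      (\<forall>m. u m = (\<Sum>i<r. g m i * u i))"
    using linear_recurrence_coefficients[of r "\<lambda>i. - Polynomial.coeff p (2 * i)"] by blast
  note g = this[rule_format]
  have gA: "(A ^\<^sub>m m *\<^sub>v all_one_vec n) $ i = (\<Sum>l<r. g m l * (A ^\<^sub>m l *\<^sub>v all_one_vec n) $ i)"
    if "i < n" for m i
    by (rule g[of "\<lambda>m. (A ^\<^sub>m m *\<^sub>v all_one_vec n) $ i"])
      (rule pow_mat_all_one_vec_recurrence[OF A idem p(1,3,4,5) that])
  have gB: "(B ^\<^sub>m m *\<^sub>v all_one_vec n) $ i = (\<Sum>l<r. g m l * (B ^\<^sub>m l *\<^sub>v all_one_vec n) $ i)"
    if "i < n" for m i
    by (rule g[of "\<lambda>m. (B ^\<^sub>m m *\<^sub>v all_one_vec n) $ i"])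
      (rule pow_mat_all_one_vec_recurrence[OF B idem p(2,3,4,5) that])
  define a where "a l = (\<Sum>k<n. c k * g k l)" for l
  have collect: "(\<Sum>k<n. c k * (\<Sum>l<r. g k l * u l)) = (\<Sum>l<r. a l * u l)" for u :: "nat \<Rightarrow> 'a"
    unfolding a_def sum_distrib_left sum_distrib_right by (subst sum.swap) (simp add: mult.assoc)
  have "a l = 0" if "l < r" for l
  proof (rule spanning_columns_independent[OF W _ r _ _ that])
    show "vec_space.rank n W = r"
      using rank by (simp add: W_def)
    show "W $$ (i, k) = (\<Sum>l<r. g k l * W $$ (i, l))" if "i < n" "k < n" for i k
      unfolding W_index[OF that] gA[OF that(1), of k]
      using that r by (intro sum.cong refl) (simp add: W_index del: index_mult_mat_vec)
    show "(\<Sum>l<r. a l * W $$ (i, l)) = 0" if "i < n" for i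
    proof -
      have "(\<Sum>l<r. a l * W $$ (i, l)) = (\<Sum>l<r. a l * (A ^\<^sub>m l *\<^sub>v all_one_vec n) $ i)"
        using that r by (intro sum.cong refl) (simp add: W_index del: index_mult_mat_vec)
      also have "\<dots> = (\<Sum>k<n. c k * (\<Sum>l<r. g k l * (A ^\<^sub>m l *\<^sub>v all_one_vec n) $ i))"
        by (rule collect[symmetric])
      also have "\<dots> = (\<Sum>k<n. c k * (A ^\<^sub>m k *\<^sub>v all_one_vec n) $ i)"
        by (intro sum.cong refl) (simp only: gA[OF that, symmetric])
      finally show ?thesis
        using zero[OF that] by simp
    qed
  qed
  then have "(\<Sum>l<r. a l * (B ^\<^sub>m l *\<^sub>v all_one_vec n) $ j) = 0"
    by simp
  then show ?thesis
    unfolding collect[symmetric] by (simp only: gB[OF j, symmetric])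
qed

section \<open>Invariant factors, level and similarity\<close>

lemma invertible_mat_inverse:
  assumes A: "A \<in> carrier_mat n n" "invertible_mat A"
  obtains A' where "A' \<in> carrier_mat n n" "A * A' = 1\<^sub>m n" "A' * A = 1\<^sub>m n"
proof -
  obtain A' where A': "A * A' = 1\<^sub>m n" "A' * A = 1\<^sub>m (dim_row A')"
    using A by (auto simp: invertible_mat_def inverts_mat_def)
  have "dim_col A' = n" "dim_row A' = n"
    using arg_cong[OF A'(1), of dim_col] arg_cong[OF A'(2), of dim_col] A(1) by auto
  then show thesis
    using that[of A'] A' by auto
qed

text \<open>Every invariant factor divides the last one, so a diagonal \<open>D\<close> satisfies
  \<open>S D = d I\<close>. Then \<open>U W (V D U) = d U\<close>, and cancelling \<open>U\<close>
  on the left gives \<open>X = V D U\<close>.\<close>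

lemma smith_normal_form_multiple:
  assumes snf: "is_smith_normal_form W S" and W: "W \<in> carrier_mat n n" and n: "n \<ge> 1"
  obtains X where "X \<in> carrier_mat n n" "W * X = S $$ (n - 1, n - 1) \<cdot>\<^sub>m 1\<^sub>m n"
proof -
  define d where "d = S $$ (n - 1, n - 1)"
  obtain U V where S: "S \<in> carrier_mat n n" "diagonal_mat S"
    and dvd: "\<And>i. i + 1 < n \<Longrightarrow> S $$ (i, i) dvd S $$ (i + 1, i + 1)"
    and U: "U \<in> carrier_mat n n" "invertible_mat U" and V: "V \<in> carrier_mat n n"
    and SUV: "S = U * W * V"
    using snf W by (auto simp: is_smith_normal_form_def)
  obtain U' where U'c: "U' \<in> carrier_mat n n" and U'U: "U' * U = 1\<^sub>m n"
    using invertible_mat_inverse[OF U] by blast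
  have dvd_d: "S $$ (i, i) dvd d" if "i \<le> n - 1" for i
    unfolding d_def using that
  proof (induction i rule: inc_induct)
    case (step i)
    then show ?case
      using dvd[of i] by (auto intro: dvd_trans)
  qed simp
  \<comment> \<open>A zero diagonal entry does no harm: it divides \<open>d\<close>, so
    \<open>d = 0\<close>, and the product of the entry with its quotient is still
    \<open>d\<close>.\<close>
  define D where "D = mat n n (\<lambda>(i, j). if i = j then d div S $$ (i, i) else 0)"
  have D: "D \<in> carrier_mat n n"
    by (simp add: D_def)
  have SD: "S * D = d \<cdot>\<^sub>m 1\<^sub>m n"
  proof (rule eq_matI)
    fix i j
    assume "i < dim_row (d \<cdot>\<^sub>m 1\<^sub>m n)" "j < dim_col (d \<cdot>\<^sub>m 1\<^sub>m n)"
    then have ij: "i < n" "j < n"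
      by auto
    have "(S * D) $$ (i, j) = (\<Sum>l<n. S $$ (i, l) * D $$ (l, j))"
      using S D ij by (simp add: scalar_prod_def atLeast0LessThan)
    also have "\<dots> = (\<Sum>l<n. if l = i then S $$ (i, i) * D $$ (i, j) else 0)"
      using S ij by (intro sum.cong refl) (auto simp: diagonal_mat_def)
    also have "\<dots> = (d \<cdot>\<^sub>m 1\<^sub>m n) $$ (i, j)"
      using ij dvd_d[of i] by (auto simp: D_def)
    finally show "(S * D) $$ (i, j) = (d \<cdot>\<^sub>m 1\<^sub>m n) $$ (i, j)" .
  qed (use S D in auto)
  note carr = U(1) U'c V W D S(1)
  note [simp] = mult_carrier_mat[of _ n n _ n] assoc_mult_mat[of _ n n _ n _ n]
  have "U * (W * (V * D * U)) = S * D * U"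
    unfolding SUV using carr by simp
  also have "\<dots> = d \<cdot>\<^sub>m U"
    unfolding SD using carr by (simp add: mult_smult_assoc_mat[of _ n n _ n])
  finally have "U' * (U * (W * (V * D * U))) = U' * (d \<cdot>\<^sub>m U)"
    by simp
  also have "\<dots> = d \<cdot>\<^sub>m 1\<^sub>m n"
    using carr U'U by (simp add: mult_smult_distrib[of _ n n _ n])
  also have "U' * (U * (W * (V * D * U))) = (U' * U) * (W * (V * D * U))"
    using carr by simp
  also have "\<dots> = W * (V * D * U)"
    unfolding U'U using carr by simp
  finally show thesis
    using that[of "V * D * U"] carr unfolding d_def by simp
qed

lemma smith_normal_form_last_pos:
  assumes snf: "is_smith_normal_form W S" and W: "W \<in> carrier_mat n n" and n: "n \<ge> 1"
    and det: "det W \<noteq> 0"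
  shows "S $$ (n - 1, n - 1) > 0"
proof -
  obtain U V where S: "S \<in> carrier_mat n n" "diagonal_mat S" "S $$ (n - 1, n - 1) \<ge> 0"
    and U: "U \<in> carrier_mat n n" "invertible_mat U"
    and V: "V \<in> carrier_mat n n" "invertible_mat V"
    and SUV: "S = U * W * V"
    using snf W n by (auto simp: is_smith_normal_form_def)
  have inv: "det M \<noteq> 0" if M: "M \<in> carrier_mat n n" "invertible_mat M" for M :: "int mat"
  proof -
    obtain M' where M': "M' \<in> carrier_mat n n" "M * M' = 1\<^sub>m n"
      using invertible_mat_inverse[OF M] by blast
    then have "det M * det M' = 1"
      using det_mult[OF M(1) M'(1)] by simp
    then show ?thesis
      by auto
  qed
  have "det S = det U * det W * det V"
    unfolding SUV using U V W det_mult[of "U * W" n V] det_mult[of U n W] by simp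
  then have "det S \<noteq> 0"
    using inv U V det by simp
  moreover have "upper_triangular S"
    using S by (auto simp: diagonal_mat_def)
  ultimately have "prod_list (diag_mat S) \<noteq> 0"
    using det_upper_triangular[OF _ S(1)] by simp
  moreover have "S $$ (n - 1, n - 1) \<in> set (diag_mat S)"
    using S(1) n by (auto simp: diag_mat_def)
  ultimately have "S $$ (n - 1, n - 1) \<noteq> 0"
    by (auto simp: prod_list_zero_iff)
  then show ?thesis
    using S(3) by simp
qed

text \<open>The multipliers clearing the denominators of \<open>Q\<close> are closed under positive
  remainders, so by minimality \<open>m mod level Q\<close> is zero.\<close>

lemma level_dvd:
  assumes Q: "Q \<in> carrier_mat n n" and m: "m > 0"
    and int: "\<And>i j. i < n \<Longrightarrow> j < n \<Longrightarrow> of_nat m * Q $$ (i, j) \<in> \<int>"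
  shows "level Q dvd m"
proof -
  define P where "P k \<longleftrightarrow> k > 0 \<and> elements_mat (of_nat k \<cdot>\<^sub>m Q) \<subseteq> \<int>" for k
  have P: "P k \<longleftrightarrow> k > 0 \<and> (\<forall>i<n. \<forall>j<n. of_nat k * Q $$ (i, j) \<in> \<int>)" for k
    using Q by (fastforce simp: P_def elements_mat_def)
  have level: "level Q = (LEAST k. P k)"
    by (simp add: level_def P_def)
  have "P m"
    using m int by (simp add: P)
  then have Pl: "P (level Q)"
    unfolding level by (rule LeastI)
  show ?thesis
  proof (rule ccontr)
    assume "\<not> level Q dvd m"
    then have "m mod level Q > 0"
      by (auto simp: dvd_eq_mod_eq_0)
    moreover have "of_nat (m mod level Q) * Q $$ (i, j) \<in> \<int>" if "i < n" "j < n" for i j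
    proof -
      have "(of_nat m :: rat) = of_nat (m div level Q) * of_nat (level Q) + of_nat (m mod level Q)"
        by (metis div_mult_mod_eq of_nat_add of_nat_mult)
      then have "of_nat (m mod level Q) * Q $$ (i, j) =
          of_nat m * Q $$ (i, j) - of_nat (m div level Q) * (of_nat (level Q) * Q $$ (i, j))"
        by (simp add: algebra_simps)
      also have "\<dots> \<in> \<int>"
        by (rule Ints_diff[OF int[OF that] Ints_mult[OF Ints_of_nat]]) (use Pl that in \<open>auto simp: P\<close>)
      finally show ?thesis .
    qed
    ultimately have "P (m mod level Q)"
      by (simp add: P)
    moreover have "m mod level Q < level Q"
      using Pl by (simp add: P)
    ultimately show False
      using not_less_Least[of _ P] level by metis
  qed
qed

text \<open>Determinants give \<open>det W * det X = d^n\<close>, so \<open>W\<close> is invertible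
  modulo \<open>p\<close> unless \<open>p\<close> divides \<open>d\<close>. The contrapositive
  yields that \<open>p\<close> divides the last invariant factor once the rank drops.\<close>

lemma rank_mod_full:
  assumes W: "W \<in> carrier_mat n n" and X: "X \<in> carrier_mat n n" "W * X = d \<cdot>\<^sub>m 1\<^sub>m n"
    and d: "\<not> int CARD('p :: prime_card) dvd d"
  shows "rank_mod TYPE('p) W = n"
proof -
  have "det W * det X = d ^ n"
    using det_mult[OF W X(1)] unfolding X(2) by simp
  then have "\<not> int CARD('p) dvd det W"
    using d prime_card_int[where 'a = 'p] by (metis dvd_mult2 prime_dvd_power)
  then have "det (map_mat of_int W :: 'p mod_ring mat) \<noteq> 0"
    by (simp add: of_int_hom.hom_det of_int_mod_ring_eq_0_iff)
  then show ?thesis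
    using vec_space.det_rank_iff[of "map_mat of_int W :: 'p mod_ring mat" n] W
    by (simp add: rank_mod_def)
qed

lemma all_one_vec_carrier [simp]: "all_one_vec n \<in> carrier_vec n"
  by (simp add: all_one_vec_def)

lemma of_int_all_one_vec: "map_vec of_int (all_one_vec n) = all_one_vec n"
  by (auto simp: all_one_vec_def)

lemma map_mat_of_int_walk:
  fixes A :: "int mat"
  assumes A: "A \<in> carrier_mat n n"
  shows "(map_mat of_int (mat_of_cols n (map (\<lambda>k. A ^\<^sub>m k *\<^sub>v all_one_vec n) [0..<n])) :: 'a :: comm_ring_1 mat) =
    mat_of_cols n (map (\<lambda>k. map_mat of_int A ^\<^sub>m k *\<^sub>v all_one_vec n) [0..<n])"
proof (rule eq_matI)
  have walk: "map_mat of_int A ^\<^sub>m k *\<^sub>v all_one_vec n = (map_vec of_int (A ^\<^sub>m k *\<^sub>v all_one_vec n) :: 'a vec)" for k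
    using A by (simp add: of_int_hom.mult_mat_vec_hom[of _ n n] of_int_hom.mat_hom_pow[of _ n] of_int_all_one_vec)
  show "(map_mat of_int (mat_of_cols n (map (\<lambda>k. A ^\<^sub>m k *\<^sub>v all_one_vec n) [0..<n])) :: 'a mat) $$ (i, j) =
      mat_of_cols n (map (\<lambda>k. map_mat of_int A ^\<^sub>m k *\<^sub>v all_one_vec n) [0..<n]) $$ (i, j)"
    if "i < dim_row (mat_of_cols n (map (\<lambda>k. map_mat of_int A ^\<^sub>m k *\<^sub>v all_one_vec n :: 'a vec) [0..<n]))"
      "j < dim_col (mat_of_cols n (map (\<lambda>k. map_mat of_int A ^\<^sub>m k *\<^sub>v all_one_vec n :: 'a vec) [0..<n]))" for i j
    unfolding walk using that A by (simp add: mat_of_cols_index del: index_mult_mat_vec)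
qed simp_all

text \<open>Each column of \<open>X\<close> modulo 2 is a relation among the walk vectors of
  \<open>A\<close>, and \<open>walk_kernel_subset\<close> carries it over to
  \<open>B\<close>.\<close>

lemma half_rank_even:
  fixes A B X :: "int mat"
  assumes A: "A \<in> carrier_mat n n" "A\<^sup>T = A" "\<And>i. i < n \<Longrightarrow> A $$ (i, i) = 0"
    and B: "B \<in> carrier_mat n n" "B\<^sup>T = B" and char_poly: "char_poly B = char_poly A"
    and p: "CARD('p :: prime_card) = 2"
    and rank: "rank_mod TYPE('p) (mat_of_cols n (map (\<lambda>k. A ^\<^sub>m k *\<^sub>v all_one_vec n) [0..<n])) = (n + n mod 2) div 2"
    and X: "X \<in> carrier_mat n n"
    and even: "\<And>i j. i < n \<Longrightarrow> j < n \<Longrightarrow>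
      even ((mat_of_cols n (map (\<lambda>k. A ^\<^sub>m k *\<^sub>v all_one_vec n) [0..<n]) * X) $$ (i, j))"
    and ij: "i < n" "j < n"
  shows "even ((mat_of_cols n (map (\<lambda>k. B ^\<^sub>m k *\<^sub>v all_one_vec n) [0..<n]) * X) $$ (i, j))"
proof -
  let ?W = "\<lambda>A. mat_of_cols n (map (\<lambda>k. A ^\<^sub>m k *\<^sub>v all_one_vec n) [0..<n])"
  let ?red = "map_mat of_int :: int mat \<Rightarrow> 'p mod_ring mat"
  have red_0: "(of_int x :: 'p mod_ring) = 0 \<longleftrightarrow> even x" for x
    using of_int_mod_ring_eq_0_iff[where 'p = 'p] p by simp
  have idem: "x * x = x" for x :: "'p mod_ring"
  proof -
    obtain y where y: "x = of_int y"
      by (metis of_int_mod_ring_to_int_mod_ring of_int_of_int_mod_ring)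
    have "(of_int (y * y - y) :: 'p mod_ring) = 0"
      unfolding red_0 by simp
    then show ?thesis
      unfolding y by (metis eq_iff_diff_eq_0 of_int_diff of_int_mult)
  qed
  have entry: "(of_int ((?W M * X) $$ (a, b)) :: 'p mod_ring) =
      (\<Sum>k<n. of_int (X $$ (k, b)) * (?red M ^\<^sub>m k *\<^sub>v all_one_vec n) $ a)"
    if M: "M \<in> carrier_mat n n" and ab: "a < n" "b < n" for M a b
  proof -
    have W: "?W M \<in> carrier_mat n n"
      by (rule carrier_matI) simp_all
    have "of_int ((?W M * X) $$ (a, b)) = (?red (?W M * X)) $$ (a, b)"
      using W X ab by simp
    also have "?red (?W M * X) = ?W (?red M) * ?red X"
      by (simp add: of_int_hom.mat_hom_mult[OF W X] map_mat_of_int_walk[OF M])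
    also have "\<dots> $$ (a, b) = (\<Sum>k<n. ?red X $$ (k, b) * (?red M ^\<^sub>m k *\<^sub>v all_one_vec n) $ a)"
      by (rule mat_of_walk_mult) (use M X ab in auto)
    also have "\<dots> = (\<Sum>k<n. of_int (X $$ (k, b)) * (?red M ^\<^sub>m k *\<^sub>v all_one_vec n) $ a)"
      using X ab by (intro sum.cong refl) simp
    finally show ?thesis .
  qed
  define s where "s = n mod 2"
  \<comment> \<open>Half of \<open>n\<close> rounded up; since \<open>n + s\<close> is even,
    multiplying a polynomial of degree \<open>n\<close> by \<open>x^s\<close> gives degree exactly
    \<open>2 * r\<close>.\<close>
  define r where "r = (n + s) div 2"
  have r: "n + s = 2 * r"
    unfolding r_def s_def by presburger
  define \<phi> where "\<phi> = char_poly (?red A)"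
  have deg: "degree \<phi> = n" "Polynomial.coeff \<phi> n = 1"
    using degree_monic_char_poly[of "?red A" n] A(1) by (auto simp: \<phi>_def)
  have \<phi>_B: "char_poly (?red B) = \<phi>"
    unfolding \<phi>_def using A(1) B(1) by (simp add: of_int_hom.char_poly_hom[of _ n] char_poly)
  \<comment> \<open>the factor makes the degree even, so that only even powers occur in \<open>f\<close>\<close>
  define f where "f = Polynomial.monom 1 s * \<phi>"
  have "(\<Sum>k<n. of_int (X $$ (k, j)) * (?red B ^\<^sub>m k *\<^sub>v all_one_vec n) $ i) = 0"
  proof (rule walk_kernel_subset[where A = "?red A" and p = f and r = r])
    show "char_poly (?red A) dvd f" "char_poly (?red B) dvd f"
      unfolding \<phi>_B by (auto simp: f_def \<phi>_def)
    have "\<phi> \<noteq> 0"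
      using deg(2) by auto
    then show "degree f = 2 * r"
      unfolding f_def using deg(1) r by (simp add: degree_mult_eq degree_monom_eq monom_eq_0_iff)
    show "Polynomial.coeff f (2 * r) = 1"
      unfolding f_def r[symmetric] using deg by (simp add: coeff_monom_mult)
    show "Polynomial.coeff f k = 0" if "odd k" for k
    proof (cases "k < s")
      case False
      \<comment> \<open>Because \<open>n + s\<close> is even, an odd \<open>k\<close> leaves
        \<open>k - s\<close> of parity opposite to \<open>n\<close>, where the coefficients of
        \<open>\<phi>\<close> vanish.\<close>
      have "odd (n + (k - s))"
        using that False r by presburger
      then have "Polynomial.coeff \<phi> (k - s) = 0"
        unfolding \<phi>_def using char_poly_symmetric_coeff_char_2[OF A, where 'a = "'p mod_ring"] p by simp
      then show ?thesis
        by (simp add: f_def coeff_monom_mult)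
    qed (simp add: f_def coeff_monom_mult)
    show "vec_space.rank n (?W (?red A)) = r"
      using rank unfolding rank_mod_def map_mat_of_int_walk[OF A(1)] by (simp add: r_def s_def)
    show "(\<Sum>k<n. of_int (X $$ (k, j)) * (?red A ^\<^sub>m k *\<^sub>v all_one_vec n) $ l) = 0" if "l < n" for l
      using even[OF that ij(2)] by (simp only: entry[OF A(1) that ij(2), symmetric] red_0)
  qed (use A B ij idem in \<open>auto simp: map_mat_transpose\<close>)
  then show ?thesis
    by (simp only: entry[OF B(1) ij, symmetric] red_0)
qed

section \<open>Conjugation by a regular rational orthogonal matrix\<close>

lemma trace_mult_commute:
  fixes P R :: "'a :: comm_semiring_0 mat"
  assumes "P \<in> carrier_mat n n" "R \<in> carrier_mat n n"
  shows "(\<Sum>i<n. (P * R) $$ (i, i)) = (\<Sum>i<n. (R * P) $$ (i, i))"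
proof -
  have "(\<Sum>i<n. (P * R) $$ (i, i)) = (\<Sum>i<n. \<Sum>k<n. P $$ (i, k) * R $$ (k, i))"
    using assms by (simp add: scalar_prod_def atLeast0LessThan)
  also have "\<dots> = (\<Sum>k<n. \<Sum>i<n. R $$ (k, i) * P $$ (i, k))"
    by (subst sum.swap) (simp add: mult.commute)
  also have "\<dots> = (\<Sum>i<n. (R * P) $$ (i, i))"
    using assms by (simp add: scalar_prod_def atLeast0LessThan)
  finally show ?thesis .
qed

text \<open>Similarity preserves the characteristic polynomial and the trace, the latter keeping the
  diagonal zero. For the walks, \<open>Q e = e\<close> gives \<open>Q\<^sup>T e = e\<close>, and
  \<open>B Q\<^sup>T = Q\<^sup>T A\<close> transports walk vectors one step at a time.\<close>

lemma regular_orthogonal_similarity: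
  fixes A :: "int mat" and Q :: "rat mat"
  assumes A: "A \<in> carrier_mat n n" "A\<^sup>T = A" "\<And>i. i < n \<Longrightarrow> A $$ (i, i) = 0"
    and Q: "Q \<in> regular_orthogonal n"
    and elements: "elements_mat (Q\<^sup>T * map_mat of_int A * Q) \<subseteq> {0, 1}"
  obtains B where "B \<in> carrier_mat n n" "B\<^sup>T = B" "\<And>i. i < n \<Longrightarrow> B $$ (i, i) = 0"
    "map_mat of_int B = Q\<^sup>T * map_mat of_int A * Q" "char_poly B = char_poly A"
    "\<And>k. map_vec of_int (B ^\<^sub>m k *\<^sub>v all_one_vec n) = Q\<^sup>T *\<^sub>v map_vec of_int (A ^\<^sub>m k *\<^sub>v all_one_vec n)"
proof -
  let ?A = "map_mat of_int A :: rat mat"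
  have Qc: "Q \<in> carrier_mat n n" and QTQ: "Q\<^sup>T * Q = 1\<^sub>m n"
    and Qe: "Q *\<^sub>v all_one_vec n = all_one_vec n"
    using Q by (auto simp: regular_orthogonal_def)
  have QT: "Q\<^sup>T \<in> carrier_mat n n" and Ac: "?A \<in> carrier_mat n n"
    using Qc A(1) by auto
  have QQT: "Q * Q\<^sup>T = 1\<^sub>m n"
    by (rule mat_mult_left_right_inverse[OF QT Qc QTQ])
  note [simp] = mult_carrier_mat[of _ n n _ n] assoc_mult_mat[of _ n n _ n _ n]
  define M where "M = Q\<^sup>T * ?A * Q"
  have M: "M \<in> carrier_mat n n"
    using QT Ac Qc by (simp add: M_def)
  have M01: "M $$ (i, j) = 0 \<or> M $$ (i, j) = 1" if "i < n" "j < n" for i j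
    using elements elements_matI[OF M that refl] unfolding M_def[symmetric] by auto
  \<comment> \<open>Only a change of type: the entries are already 0 or 1, so rounding down alters
    nothing.\<close>
  define B where "B = map_mat floor M"
  have B: "B \<in> carrier_mat n n"
    using M by (simp add: B_def)
  have BM: "map_mat of_int B = M"
  proof (rule eq_matI)
    fix i j
    assume "i < dim_row M" "j < dim_col M"
    then show "map_mat of_int B $$ (i, j) = M $$ (i, j)"
      using M01[of i j] M by (auto simp: B_def)
  qed (use M in \<open>auto simp: B_def\<close>)
  have "M\<^sup>T = M"
    unfolding M_def using QT Ac Qc A(2)
    by (simp add: transpose_mult[of _ n n _ n] map_mat_transpose)
  then have BT: "B\<^sup>T = B"
    unfolding B_def by (simp add: map_mat_transpose)
  \<comment> \<open>The zero diagonal comes from the trace: it equals that of \<open>A\<close>,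
    which is zero, and the diagonal entries are nonnegative.\<close>
  have "(\<Sum>i<n. M $$ (i, i)) = (\<Sum>i<n. (?A * Q * Q\<^sup>T) $$ (i, i))"
    using trace_mult_commute[of "Q\<^sup>T" n "?A * Q"] QT Ac Qc by (simp add: M_def)
  also have "?A * Q * Q\<^sup>T = ?A"
    using Ac Qc QT QQT by simp
  also have "(\<Sum>i<n. ?A $$ (i, i)) = 0"
    using A(1,3) by simp
  finally have "\<forall>i\<in>{..<n}. M $$ (i, i) = 0"
    using M01 by (subst (asm) sum_nonneg_eq_0_iff) force+
  then have Bd: "B $$ (i, i) = 0" if "i < n" for i
    using that M by (simp add: B_def)
  have "similar_mat (map_mat of_int B :: rat mat) ?A"
    unfolding BM by (rule similar_matI[of _ _ "Q\<^sup>T" Q n]) (use M QT Ac Qc QTQ QQT in \<open>auto simp: M_def\<close>)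
  then have "char_poly (map_mat of_int B :: rat mat) = char_poly ?A"
    by (rule char_poly_similar)
  then have "(map_poly of_int (char_poly B) :: rat poly) = map_poly of_int (char_poly A)"
    using of_int_hom.char_poly_hom[OF A(1), where ?'a = rat] of_int_hom.char_poly_hom[OF B, where ?'a = rat] by simp
  then have "of_int (Polynomial.coeff (char_poly B) k) = (of_int (Polynomial.coeff (char_poly A) k) :: rat)" for k
    by (metis coeff_map_poly of_int_0)
  then have char: "char_poly B = char_poly A"
    by (intro poly_eqI) simp
  have walk: "map_vec of_int (B ^\<^sub>m k *\<^sub>v all_one_vec n) = Q\<^sup>T *\<^sub>v map_vec of_int (A ^\<^sub>m k *\<^sub>v all_one_vec n)" for k
  proof (induction k)
    case 0
    have "Q\<^sup>T *\<^sub>v all_one_vec n = Q\<^sup>T *\<^sub>v (Q *\<^sub>v all_one_vec n)"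
      unfolding Qe ..
    also have "\<dots> = all_one_vec n"
      using assoc_mult_mat_vec[OF QT Qc, of "all_one_vec n"] QTQ by simp
    finally show ?case
      using A(1) B by (simp add: of_int_all_one_vec)
  next
    case (Suc k)
    define a where "a = (map_vec of_int (A ^\<^sub>m k *\<^sub>v all_one_vec n) :: rat vec)"
    have walk_c: "C ^\<^sub>m k *\<^sub>v all_one_vec n \<in> carrier_vec n" if "C \<in> carrier_mat n n" for C :: "int mat"
      using that by (intro mult_mat_vec_carrier[of _ n n]) auto
    have a: "a \<in> carrier_vec n"
      using walk_c[OF A(1)] by (simp add: a_def)
    have "map_vec of_int (B ^\<^sub>m Suc k *\<^sub>v all_one_vec n) = M *\<^sub>v (Q\<^sup>T *\<^sub>v a)"
      unfolding pow_mat_Suc_mult_vec[OF B all_one_vec_carrier]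
        of_int_hom.mult_mat_vec_hom[OF B walk_c[OF B]] BM Suc a_def ..
    also have "\<dots> = (M * Q\<^sup>T) *\<^sub>v a"
      using assoc_mult_mat_vec[OF M QT a] by simp
    also have "M * Q\<^sup>T = Q\<^sup>T * ?A"
      unfolding M_def using QT Ac Qc QQT by simp
    also have "\<dots> *\<^sub>v a = Q\<^sup>T *\<^sub>v (?A *\<^sub>v a)"
      by (rule assoc_mult_mat_vec[OF QT Ac a])
    also have "?A *\<^sub>v a = map_vec of_int (A ^\<^sub>m Suc k *\<^sub>v all_one_vec n)"
      unfolding pow_mat_Suc_mult_vec[OF A(1) all_one_vec_carrier]
        of_int_hom.mult_mat_vec_hom[OF A(1) walk_c[OF A(1)]] a_def ..
    finally show ?case .
  qed
  show thesis
    by (rule that[OF B BT Bd _ char walk]) (simp_all add: BM M_def)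
qed

lemma level_dvd_div:
  fixes R :: "int mat"
  assumes Q: "Q \<in> carrier_mat n n" and R: "R \<in> carrier_mat n n" "map_mat of_int R = of_int d \<cdot>\<^sub>m Q"
    and d: "d > 0" and p: "p > 0" "p dvd d"
    and dvd: "\<And>i j. i < n \<Longrightarrow> j < n \<Longrightarrow> p dvd R $$ (i, j)"
  shows "int (level Q) dvd d div p"
proof -
  obtain m where m: "d = p * m"
    using p(2) by (elim dvdE)
  have "m > 0"
    using d p(1) m by (simp add: zero_less_mult_iff)
  have "level Q dvd nat m"
  proof (rule level_dvd[OF Q])
    show "of_nat (nat m) * Q $$ (i, j) \<in> \<int>" if ij: "i < n" "j < n" for i j
    proof -
      obtain t where t: "R $$ (i, j) = p * t"
        using dvd[OF ij] by (elim dvdE)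
      have "map_mat of_int R $$ (i, j) = of_int d * Q $$ (i, j)"
        unfolding R(2) using Q ij by simp
      then have "of_int p * (of_int m * Q $$ (i, j)) = of_int p * (of_int t :: rat)"
        using R(1) ij by (auto simp: t m)
      then have "of_int m * Q $$ (i, j) = of_int t"
        using p(1) by simp
      then show ?thesis
        using \<open>m > 0\<close> by (simp add: of_nat_nat)
    qed
  qed (use \<open>m > 0\<close> in simp)
  then have "int (level Q) dvd int (nat m)"
    by (simp only: of_nat_dvd_iff)
  then show ?thesis
    using \<open>m > 0\<close> p(1) by (simp add: m)
qed

section \<open>Passage from the walk matrix to \<open>R = d Q\<close>, and the two rank
  hypotheses\<close>

theorem theorem2p8:
  fixes G :: "'v pair_pre_digraph" and vs :: "'v list" and n p l :: nat
    and W S :: "int mat" and d\<^sub>n :: int and Q :: "rat mat"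
  assumes graph: "pair_graph G"
    and vertices: "distinct vs" "set vs = pverts G" "length vs = n"
    and nonempty: "n \<ge> 1"
    and W: "W = walk_mat G vs"
    and det: "det W \<noteq> 0"
    and invariant_factor: "is_smith_normal_form W S" "d\<^sub>n = S $$ (n - 1, n - 1)"
    and Q: "Q \<in> regular_orthogonal_of G vs"
    and level: "level Q = l"
    and p: "p = CARD('p :: prime_card)"
  shows
    \<comment> \<open>In the second part \<open>n \<ge> 2\<close> is needed: for the one-vertex graph \<open>\<lceil>n/2\<rceil> = n\<close>,
        \<open>d\<^sub>n = 1\<close>, and \<open>d\<^sub>n/2\<close> is not an integer.\<close>
    "(odd p \<longrightarrow> rank_mod TYPE('p) W = n - 1 \<longrightarrow>
        int p dvd d\<^sub>n \<and> int l dvd d\<^sub>n div int p) \<and>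
     (p = 2 \<longrightarrow> n \<ge> 2 \<longrightarrow> int (rank_mod TYPE('p) W) = \<lceil>real n / 2\<rceil> \<longrightarrow>
        2 dvd d\<^sub>n \<and> int l dvd d\<^sub>n div 2)"
proof -
  define A where "A = adjacency_mat G vs"
  let ?e = "all_one_vec n :: int vec"
  interpret pair_graph G
    by (rule graph)
  have A: "A \<in> carrier_mat n n"
    using vertices by (simp add: A_def adjacency_mat_def)
  have AT: "A\<^sup>T = A"
    using vertices by (intro eq_matI) (auto simp: A_def adjacency_mat_def intro: arcs_symmetric)
  have Ad: "A $$ (i, i) = 0" if "i < n" for i
    using that vertices no_loops' by (auto simp: A_def adjacency_mat_def)
  have W_def': "W = mat_of_cols n (map (\<lambda>k. A ^\<^sub>m k *\<^sub>v ?e) [0..<n])"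
    using vertices by (simp add: W walk_mat_def A_def Let_def)
  have Wc: "W \<in> carrier_mat n n"
    by (rule carrier_matI) (simp_all add: W_def')
  obtain X where X: "X \<in> carrier_mat n n" "W * X = d\<^sub>n \<cdot>\<^sub>m 1\<^sub>m n"
    using smith_normal_form_multiple[OF invariant_factor(1) Wc nonempty] invariant_factor(2) by metis
  have d: "d\<^sub>n > 0"
    using smith_normal_form_last_pos[OF invariant_factor(1) Wc nonempty det] invariant_factor(2) by simp
  have Qr: "Q \<in> regular_orthogonal n" and Qel: "elements_mat (Q\<^sup>T * map_mat of_int A * Q) \<subseteq> {0, 1}"
    using Q vertices by (auto simp: regular_orthogonal_of_def A_def)
  have Qc: "Q \<in> carrier_mat n n" and QTQ: "Q\<^sup>T * Q = 1\<^sub>m n" and Qe: "Q *\<^sub>v all_one_vec n = all_one_vec n"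
    using Qr by (auto simp: regular_orthogonal_def)
  have QT: "Q\<^sup>T \<in> carrier_mat n n"
    using Qc by simp
  have QQT: "Q * Q\<^sup>T = 1\<^sub>m n"
    by (rule mat_mult_left_right_inverse[OF QT Qc QTQ])
  obtain B where B: "B \<in> carrier_mat n n" "B\<^sup>T = B" "\<And>i. i < n \<Longrightarrow> B $$ (i, i) = 0"
    and BQ: "map_mat of_int B = Q\<^sup>T * map_mat of_int A * Q" and char: "char_poly B = char_poly A"
    and walk: "\<And>k. map_vec of_int (B ^\<^sub>m k *\<^sub>v ?e) = Q\<^sup>T *\<^sub>v map_vec of_int (A ^\<^sub>m k *\<^sub>v ?e)"
    using regular_orthogonal_similarity[OF A AT Ad Qr Qel] by metis
  define H where "H = mat_of_cols n (map (\<lambda>k. B ^\<^sub>m k *\<^sub>v ?e) [0..<n])"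
  have H: "H \<in> carrier_mat n n"
    by (rule carrier_matI) (simp_all add: H_def)
  have HW: "map_mat of_int H = Q\<^sup>T * map_mat of_int W"
  proof (rule mat_col_eqI)
    fix k
    assume "k < dim_col (Q\<^sup>T * map_mat of_int W)"
    then have k: "k < n"
      using Wc by simp
    have walk_c: "C ^\<^sub>m k *\<^sub>v ?e \<in> carrier_vec n" if "C \<in> carrier_mat n n" for C
      using that by (intro mult_mat_vec_carrier[of _ n n]) auto
    have "col (map_mat of_int H) k = map_vec of_int (B ^\<^sub>m k *\<^sub>v ?e)"
      using k H walk_c[OF B(1)] by (simp add: H_def)
    also have "\<dots> = Q\<^sup>T *\<^sub>v col (map_mat of_int W) k"
      unfolding walk using k Wc walk_c[OF A] by (simp add: W_def')
    also have "\<dots> = col (Q\<^sup>T * map_mat of_int W) k"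
      using k Wc QT by (simp add: mult_mat_vec_def)
    finally show "col (map_mat of_int H) k = col (Q\<^sup>T * map_mat of_int W) k" .
  qed (use H Wc QT in auto)
  have transpose_smult: "(c \<cdot>\<^sub>m M)\<^sup>T = c \<cdot>\<^sub>m M\<^sup>T" for c and M :: "rat mat"
    by (auto intro!: eq_matI)
  \<comment> \<open>\<open>H X = Q\<^sup>T W X = d Q\<^sup>T\<close>, hence the transpose.\<close>
  define R where "R = (H * X)\<^sup>T"
  have R: "R \<in> carrier_mat n n"
    using H X(1) by (simp add: R_def)
  have RQ: "map_mat of_int R = of_int d\<^sub>n \<cdot>\<^sub>m Q"
  proof -
    have "map_mat of_int (H * X) = Q\<^sup>T * map_mat of_int W * map_mat of_int X"
      by (simp add: of_int_hom.mat_hom_mult[OF H X(1)] HW)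
    also have "\<dots> = Q\<^sup>T * map_mat of_int (W * X)"
      using assoc_mult_mat[OF QT, of "map_mat of_int W" n "map_mat of_int X" n] Wc X(1)
      by (simp add: of_int_hom.mat_hom_mult[OF Wc X(1)])
    also have "map_mat of_int (W * X) = (of_int d\<^sub>n \<cdot>\<^sub>m 1\<^sub>m n :: rat mat)"
      unfolding X(2) by (auto intro!: eq_matI)
    also have "Q\<^sup>T * \<dots> = of_int d\<^sub>n \<cdot>\<^sub>m Q\<^sup>T"
      using QT mult_smult_distrib[OF QT, of "1\<^sub>m n" n "of_int d\<^sub>n"] by simp
    finally have "(map_mat of_int (H * X))\<^sup>T = (of_int d\<^sub>n \<cdot>\<^sub>m Q\<^sup>T)\<^sup>T"
      by simp
    then show ?thesis
      by (simp add: R_def map_mat_transpose transpose_smult)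
  qed
  \<comment> \<open>Shared by both cases: singularity of \<open>W\<close> modulo \<open>p\<close>
    already forces \<open>p\<close> to divide the last invariant factor, so each case only has to
    show that \<open>p\<close> divides \<open>R\<close>.\<close>
  have conclude: "int p dvd d\<^sub>n \<and> int l dvd d\<^sub>n div int p"
    if rank_ne: "rank_mod TYPE('p) W \<noteq> n"
      and dvd: "\<And>i j. int p dvd d\<^sub>n \<Longrightarrow> i < n \<Longrightarrow> j < n \<Longrightarrow> int p dvd R $$ (i, j)"
  proof -
    have pd: "int p dvd d\<^sub>n"
      using rank_mod_full[OF Wc X, where 'p = 'p] rank_ne p by blast
    have "p > 0"
      unfolding p using prime_card[where 'a = 'p] by (rule prime_gt_0_nat)
    then show ?thesis
      using level_dvd_div[OF Qc R RQ d _ pd dvd[OF pd]] pd level by simp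
  qed
  have smult_mult: "(c \<cdot>\<^sub>m Q\<^sup>T) *\<^sub>v v = c \<cdot>\<^sub>v (Q\<^sup>T *\<^sub>v v)" if "v \<in> carrier_vec n" for c v
    using that Qc by (intro eq_vecI) (auto simp: scalar_prod_def sum_distrib_left mult.assoc)
  have odd_case: "int p dvd d\<^sub>n \<and> int l dvd d\<^sub>n div int p" if rank: "rank_mod TYPE('p) W = n - 1"
  proof (rule conclude)
    show "rank_mod TYPE('p) W \<noteq> n"
      using rank nonempty by simp
    show "int p dvd R $$ (i, j)" if pd: "int p dvd d\<^sub>n" and ij: "i < n" "j < n" for i j
      unfolding p
    proof (rule corank_one_divisible[OF A AT B(1,3) all_one_vec_carrier W_def' nonempty rank X _ _ R])
      note [simp] = mult_carrier_mat[of _ n n _ n] assoc_mult_mat[of _ n n _ n _ n]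
      have Ar: "map_mat of_int A \<in> carrier_mat n n"
        using A by simp
      show "d\<^sub>n \<noteq> 0" "int CARD('p) dvd d\<^sub>n"
        using d pd p by auto
      \<comment> \<open>The integral identities for \<open>R\<close> are checked over the rationals,
        where \<open>R = d Q\<close>, and pulled back by injectivity of
        \<open>of_int\<close>.\<close>
      have "(map_mat of_int (A * R) :: rat mat) = of_int d\<^sub>n \<cdot>\<^sub>m (map_mat of_int A * Q)"
        using mult_smult_distrib[OF Ar Qc] by (simp add: of_int_hom.mat_hom_mult[OF A R] RQ)
      also have "map_mat of_int A * Q = Q * map_mat of_int B"
      proof -
        have "Q * map_mat of_int B = (Q * Q\<^sup>T) * (map_mat of_int A * Q)"
          unfolding BQ using Qc QT Ar by simp
        then show ?thesis
          unfolding QQT using Qc Ar by simp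
      qed
      also have "of_int d\<^sub>n \<cdot>\<^sub>m (Q * map_mat of_int B) = map_mat of_int (R * B)"
        using mult_smult_assoc_mat[OF Qc, of "map_mat of_int B" n] B(1)
        by (simp add: of_int_hom.mat_hom_mult[OF R B(1)] RQ)
      finally show "A * R = R * B"
        by (rule of_int_hom.mat_hom_inj)
      have RT: "R\<^sup>T \<in> carrier_mat n n"
        using R by simp
      have RTQ: "map_mat of_int R\<^sup>T = of_int d\<^sub>n \<cdot>\<^sub>m Q\<^sup>T"
        using arg_cong[OF RQ, of transpose_mat] by (simp add: map_mat_transpose transpose_smult)
      have "(map_mat of_int (R\<^sup>T * R) :: rat mat) = (of_int d\<^sub>n \<cdot>\<^sub>m Q\<^sup>T) * (of_int d\<^sub>n \<cdot>\<^sub>m Q)"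
        by (simp add: of_int_hom.mat_hom_mult[OF RT R] RQ RTQ)
      also have "\<dots> = of_int d\<^sub>n \<cdot>\<^sub>m (of_int d\<^sub>n \<cdot>\<^sub>m (Q\<^sup>T * Q))"
        using mult_smult_assoc_mat[OF QT, of "of_int d\<^sub>n \<cdot>\<^sub>m Q" n] mult_smult_distrib[OF QT Qc] Qc by simp
      also have "\<dots> = map_mat of_int (d\<^sub>n\<^sup>2 \<cdot>\<^sub>m 1\<^sub>m n)"
        unfolding QTQ by (auto intro!: eq_matI simp: power2_eq_square)
      finally show "R\<^sup>T * R = d\<^sub>n\<^sup>2 \<cdot>\<^sub>m 1\<^sub>m n"
        by (rule of_int_hom.mat_hom_inj)
      have "Q\<^sup>T *\<^sub>v all_one_vec n = Q\<^sup>T *\<^sub>v (Q *\<^sub>v all_one_vec n)"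
        unfolding Qe ..
      also have "\<dots> = all_one_vec n"
        using assoc_mult_mat_vec[OF QT Qc, of "all_one_vec n"] QTQ by simp
      finally have "(of_int d\<^sub>n \<cdot>\<^sub>m Q\<^sup>T) *\<^sub>v all_one_vec n = of_int d\<^sub>n \<cdot>\<^sub>v (all_one_vec n :: rat vec)"
        by (simp add: smult_mult)
      then have "(map_vec of_int (R\<^sup>T *\<^sub>v ?e) :: rat vec) = map_vec of_int (d\<^sub>n \<cdot>\<^sub>v ?e)"
        by (simp add: of_int_hom.mult_mat_vec_hom[OF RT] RTQ of_int_all_one_vec of_int_hom.vec_hom_smult)
      then show "R\<^sup>T *\<^sub>v ?e = d\<^sub>n \<cdot>\<^sub>v ?e"
        by (rule of_int_hom.vec_hom_inj)
    qed (use ij in auto)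
  qed
  have two_case: "int p dvd d\<^sub>n \<and> int l dvd d\<^sub>n div int p"
    if p2: "p = 2" and n2: "n \<ge> 2" and rank: "int (rank_mod TYPE('p) W) = \<lceil>real n / 2\<rceil>"
  proof (rule conclude)
    have "\<lceil>real n / 2\<rceil> = int ((n + n mod 2) div 2)"
      by (cases "even n") (auto elim!: evenE oddE simp: ceiling_eq_iff)
    then have rank': "rank_mod TYPE('p) W = (n + n mod 2) div 2"
      using rank by simp
    \<comment> \<open>For \<open>n \<ge> 2\<close>, half of \<open>n\<close> rounded up is less than
      \<open>n\<close>.\<close>
    then show "rank_mod TYPE('p) W \<noteq> n"
      using n2 by (cases "even n") (auto elim!: evenE oddE)
    show "int p dvd R $$ (i, j)" if pd: "int p dvd d\<^sub>n" and ij: "i < n" "j < n" for i j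
    proof -
      \<comment> \<open>\<open>W X = d I\<close> with \<open>d\<close> even makes every column of
        \<open>X\<close> a kernel vector of \<open>W\<close> modulo 2. The indices are swapped below
        because \<open>R\<close> is a transpose.\<close>
      have "even ((W * X) $$ (a, b))" if "a < n" "b < n" for a b
        unfolding X(2) using that pd p2 by simp
      then have "even ((H * X) $$ (j, i))"
        unfolding H_def W_def'
        by (intro half_rank_even[OF A AT Ad B(1,2) char _ _ X(1), where 'p = 'p])
          (use p p2 rank' ij in \<open>auto simp: W_def'\<close>)
      then show ?thesis
        using p2 ij H X(1) by (simp add: R_def)
    qed
  qed
  show ?thesis
    using odd_case two_case by auto
qed

end
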